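(* Let $(M,d)$ be a complete pointed metric space with base point $0$. Let $\mu$ be a positive Radon measure on $\beta\widetilde{M}$ that is $\preccurlyeq$-minimal, concentrated on $\mathcal{R}:=p^{-1}(\mathcal{R}(M)\times\mathcal{R}(M))$, and satisfies $\Phi^*\mu\in\mathcal{F}(M)$. Then $\mu(\Gamma)=0$, where $\Gamma=p^{-1}\big((\mathcal{R}(M)\setminus M)\times(\mathcal{R}(M)\setminus M)\big)$.
   Context: $\mathrm{Lip}_0(M)$: Lipschitz $f:M\to\mathbb{R}$ with $f(0)=0$, normed by Lipschitz constant; $\mathcal{F}(M)\subset\mathrm{Lip}_0(M)^*$ is the closed linear span of the evaluation functionals $\delta(x)$, $x\in M$. $\widetilde{M}=\{(x,y)\in M\times M:x\ne y\}$, $\beta\widetilde{M}$ its Stone–Čech compactification, Radon measures on it identified with $C(\beta\widetilde{M})^*$. $\Phi:\mathrm{Lip}_0(M)\to C(\beta\widetilde{M})$ maps $f$ to the continuous extension of $(x,y)\mapsto(f(x)-f(y))/d(x,y)$; $\Phi^*$ is its adjoint. $M^u$ is the uniform (Samuel) compactification of $M$; $p_1,p_2:\beta\widetilde{M}\to M^u$ continuously extend the coordinate projections and $p=(p_1,p_2)$. $\mathcal{R}(M)=\{\xi\in M^u:\overline{d_0}(\xi)<\infty\}$ is the Lipschitz realcompactification, where $\overline{d_0}:M^u\to[0,\infty]$ is the continuous extension of $x\mapsto d(x,0)$. $G$ is the set of $g\in C(\beta\widetilde{M})$ with $d(x,y)g(x,y)\le d(x,u)g(x,u)+d(u,y)g(u,y)$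 for all distinct $x,u,y\in M$; for positive Radon measures, $\mu\preccurlyeq\nu$ iff $\int g\,d\mu\le\int g\,d\nu$ for all $g\in G$; $\mu$ is $\preccurlyeq$-minimal if every positive $\nu\preccurlyeq\mu$ satisfies $\mu\preccurlyeq\nu$. Throughout, $M$ has at least three distinct points. *)

theory Defs
  imports "HOL-Analysis.Analysis" "HOL-Probability.Probability"
begin

definition borel_of :: "'a topology \<Rightarrow> 'a measure" where
  "borel_of X = sigma (topspace X) {U. openin X U}"

definition pos_radon :: "'a topology \<Rightarrow> 'a measure \<Rightarrow> bool" where
  "pos_radon X \<mu> \<longleftrightarrow> sets \<mu> = sets (borel_of X) \<and> space \<mu> = topspace X
     \<and> emeasure \<mu> (space \<mu>) < \<infinity>
     \<and> (\<forall>A\<in>sets \<mu>. emeasure \<mu> A = (SUP K\<in>{K. compactin X K \<and> K \<subseteq> A}. emeasure \<mu> K))"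

definition cext :: "'b topology \<Rightarrow> 'c topology \<Rightarrow> ('a \<Rightarrow> 'b) \<Rightarrow> 'a set \<Rightarrow> ('a \<Rightarrow> 'c) \<Rightarrow> 'b \<Rightarrow> 'c" where
  "cext X Y e A f = (THE F. continuous_map X Y F \<and> (\<forall>a\<in>A. F (e a) = f a)
                          \<and> (\<forall>x. x \<notin> topspace X \<longrightarrow> F x = undefined))"

definition Mtil :: "('a::metric_space \<times> 'a) set" where
  "Mtil = {(x,y). x \<noteq> y}"

definition betaIdx :: "(('a::metric_space \<times> 'a) \<Rightarrow> real) set" where
  "betaIdx = {g. continuous_on Mtil g \<and> g ` Mtil \<subseteq> {0..1} \<and> (\<forall>z. z \<notin> Mtil \<longrightarrow> g z = 0)}"

definition betaEmb :: "('a::metric_space \<times> 'a) \<Rightarrow> ((('a \<times> 'a) \<Rightarrow> real) \<Rightarrow> real)" where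
  "betaEmb z = restrict (\<lambda>g. g z) betaIdx"

text \<open>Stone-Cech compactification of Mtil: closure of the evaluation embedding
  in the cube [0,1]^betaIdx.\<close>
definition betaTop :: "((('a::metric_space \<times> 'a) \<Rightarrow> real) \<Rightarrow> real) topology" where
  "betaTop = (let P = product_topology (\<lambda>_. top_of_set {0..1::real}) betaIdx
              in subtopology P (P closure_of (betaEmb ` Mtil)))"

text \<open>Index set for the uniform (Samuel) compactification: uniformly continuous maps M \<rightarrow> [0,1].\<close>
definition uIdx :: "('a::metric_space \<Rightarrow> real) set" where
  "uIdx = {u. uniformly_continuous_on UNIV u \<and> range u \<subseteq> {0..1}}"

definition uEmb :: "'a::metric_space \<Rightarrow> (('a \<Rightarrow> real) \<Rightarrow> real)" where
  "uEmb x = restrict (\<lambda>u. u x) uIdx"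

definition uTop :: "((('a::metric_space) \<Rightarrow> real) \<Rightarrow> real) topology" where
  "uTop = (let P = product_topology (\<lambda>_. top_of_set {0..1::real}) uIdx
           in subtopology P (P closure_of range uEmb))"

definition p1 :: "((('a::metric_space \<times> 'a) \<Rightarrow> real) \<Rightarrow> real) \<Rightarrow> (('a \<Rightarrow> real) \<Rightarrow> real)" where
  "p1 = cext betaTop uTop betaEmb Mtil (\<lambda>z. uEmb (fst z))"

definition p2 :: "((('a::metric_space \<times> 'a) \<Rightarrow> real) \<Rightarrow> real) \<Rightarrow> (('a \<Rightarrow> real) \<Rightarrow> real)" where
  "p2 = cext betaTop uTop betaEmb Mtil (\<lambda>z. uEmb (snd z))"

definition d0bar :: "'a::metric_space \<Rightarrow> (('a \<Rightarrow> real) \<Rightarrow> real) \<Rightarrow> ereal" where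
  "d0bar x0 = cext uTop (euclidean :: ereal topology) uEmb UNIV (\<lambda>x. ereal (dist x x0))"

definition RM :: "'a::metric_space \<Rightarrow> (('a \<Rightarrow> real) \<Rightarrow> real) set" where
  "RM x0 = {\<xi> \<in> topspace uTop. d0bar x0 \<xi> < \<infinity>}"

definition Lip0 :: "'a::metric_space \<Rightarrow> ('a \<Rightarrow> real) set" where
  "Lip0 x0 = {f. (\<exists>C. C-lipschitz_on UNIV f) \<and> f x0 = 0}"

definition Phi :: "('a::metric_space \<Rightarrow> real) \<Rightarrow> ((('a \<times> 'a) \<Rightarrow> real) \<Rightarrow> real) \<Rightarrow> real" where
  "Phi f = cext betaTop euclideanreal betaEmb Mtil (\<lambda>(x,y). (f x - f y) / dist x y)"

definition Gset :: "(((('a::metric_space \<times> 'a) \<Rightarrow> real) \<Rightarrow> real) \<Rightarrow> real) set" where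
  "Gset = {g. continuous_map betaTop euclideanreal g \<and>
     (\<forall>x u y. x \<noteq> u \<and> u \<noteq> y \<and> x \<noteq> y \<longrightarrow>
        dist x y * g (betaEmb (x,y)) \<le> dist x u * g (betaEmb (x,u)) + dist u y * g (betaEmb (u,y)))}"

definition preceq :: "((('a::metric_space \<times> 'a) \<Rightarrow> real) \<Rightarrow> real) measure \<Rightarrow> ((('a \<times> 'a) \<Rightarrow> real) \<Rightarrow> real) measure \<Rightarrow> bool" where
  "preceq \<mu> \<nu> \<longleftrightarrow> (\<forall>g\<in>Gset. integral\<^sup>L \<mu> g \<le> integral\<^sup>L \<nu> g)"

definition preceq_minimal :: "((('a::metric_space \<times> 'a) \<Rightarrow> real) \<Rightarrow> real) measure \<Rightarrow> bool" where
  "preceq_minimal \<mu> \<longleftrightarrow> (\<forall>\<nu>. pos_radon betaTop \<nu> \<and> preceq \<nu> \<mu> \<longrightarrow> preceq \<mu> \<nu>)"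

text \<open>Phi^* mu belongs to F(M): it lies in the norm closure (in Lip_0(M)^*) of the span
  of the evaluation functionals delta(x).\<close>
definition PhiStar_in_F :: "'a::metric_space \<Rightarrow> ((('a \<times> 'a) \<Rightarrow> real) \<Rightarrow> real) measure \<Rightarrow> bool" where
  "PhiStar_in_F x0 \<mu> \<longleftrightarrow> (\<forall>\<epsilon>>0. \<exists>S a. finite S \<and>
      (\<forall>f\<in>Lip0 x0. 1-lipschitz_on UNIV f \<longrightarrow>
          \<bar>integral\<^sup>L \<mu> (Phi f) - (\<Sum>x\<in>S. a x * f x)\<bar> \<le> \<epsilon>))"

end

theory Submission
  imports Defs
begin

text \<open>
  Hahn--Banach and Riesz representation turn minimality into a dual statement: for \<open>g\<^sub>0 \<in> G\<close>
  there are \<open>g \<in> G\<close> with \<open>g \<ge> -g\<^sub>0\<close> and \<open>\<integral>(g + g\<^sub>0) d\<mu>\<close> arbitrarily small. Take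
  \<open>g\<^sub>0(x,y) = min(\<delta>, d(x,y)) / d(x,y)\<close>, so that \<open>H = d g\<close> is a hemimetric bounded below by
  \<open>-min(\<delta>, d)\<close>. Membership of \<open>\<Phi>\<^sup>*\<mu>\<close> in \<open>\<F>(M)\<close> provides a finite set \<open>S\<close>
  such that \<open>\<integral>\<Phi>F d\<mu>\<close> is negligible for every Lipschitz \<open>F\<close> vanishing on \<open>S\<close>, even
  relative to the Lipschitz constant of \<open>H\<close>. For
  \<open>F(x) = max(0, min {H(s,x) | s \<in> S} + min(\<delta>, d(x,S)))\<close> one has \<open>-\<Phi>F \<le> g + g\<^sub>0\<close> everywhere, and
  even \<open>-\<Phi>F \<le> g\<close> where both coordinates are at distance \<open>\<ge> \<delta>\<close> from \<open>S\<close>. Integrating,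
  \<open>g\<^sub>0\<close> has integral zero over the set of points both of whose coordinates are at distance
  \<open>> \<delta>\<close> from all of \<open>M\<close>. By completeness, points of \<open>\<R>(M) - M\<close> have positive distance
  to \<open>M\<close>, so these sets exhaust \<open>\<Gamma>\<close> as \<open>\<delta>\<close> tends to \<open>0\<close>, and \<open>g\<^sub>0 > 0\<close> on \<open>\<Gamma>\<close>.
\<close>

section \<open>Hahn--Banach for sublinear functionals on function spaces\<close>

definition function_space :: "('b \<Rightarrow> real) set \<Rightarrow> bool" where
  "function_space V \<longleftrightarrow> V \<noteq> {} \<and> (\<forall>f\<in>V. \<forall>g\<in>V. (\<lambda>x. f x + g x) \<in> V) \<and> (\<forall>f\<in>V. \<forall>c. (\<lambda>x. c * f x) \<in> V)"

definition sublinear_on :: "('b \<Rightarrow> real) set \<Rightarrow> (('b \<Rightarrow> real) \<Rightarrow> real) \<Rightarrow> bool" where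
  "sublinear_on V q \<longleftrightarrow> (\<forall>f\<in>V. \<forall>g\<in>V. q (\<lambda>x. f x + g x) \<le> q f + q g)
     \<and> (\<forall>f\<in>V. \<forall>c\<ge>0. q (\<lambda>x. c * f x) = c * q f)"

definition linear_functional_on :: "('b \<Rightarrow> real) set \<Rightarrow> (('b \<Rightarrow> real) \<Rightarrow> real) \<Rightarrow> bool" where
  "linear_functional_on V L \<longleftrightarrow> (\<forall>f\<in>V. \<forall>g\<in>V. L (\<lambda>x. f x + g x) = L f + L g)
     \<and> (\<forall>f\<in>V. \<forall>c. L (\<lambda>x. c * f x) = c * L f)"

lemma function_spaceD:
  assumes "function_space V"
  shows "f \<in> V \<Longrightarrow> g \<in> V \<Longrightarrow> (\<lambda>x. f x + g x) \<in> V" "f \<in> V \<Longrightarrow> (\<lambda>x. c * f x) \<in> V"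
    "f \<in> V \<Longrightarrow> (\<lambda>x. - f x) \<in> V" "(\<lambda>x. 0) \<in> V"
proof -
  show *: "f \<in> V \<Longrightarrow> (\<lambda>x. c * f x) \<in> V" for c f
    using assms by (auto simp: function_space_def)
  show "f \<in> V \<Longrightarrow> g \<in> V \<Longrightarrow> (\<lambda>x. f x + g x) \<in> V"
    using assms by (auto simp: function_space_def)
  show "f \<in> V \<Longrightarrow> (\<lambda>x. - f x) \<in> V" using *[of f "-1"] by simp
  obtain h where "h \<in> V" using assms by (auto simp: function_space_def)
  then show "(\<lambda>x. 0) \<in> V" using *[of h 0] by simp
qed

lemma sublinear_onD:
  assumes "sublinear_on V q"
  shows "f \<in> V \<Longrightarrow> g \<in> V \<Longrightarrow> q (\<lambda>x. f x + g x) \<le> q f + q g"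
    "f \<in> V \<Longrightarrow> c \<ge> 0 \<Longrightarrow> q (\<lambda>x. c * f x) = c * q f"
  using assms by (auto simp: sublinear_on_def)

lemma sublinear_on_zero:
  assumes "function_space V" "sublinear_on V q"
  shows "q (\<lambda>x. 0) = 0"
  using sublinear_onD(2)[OF assms(2) function_spaceD(4)[OF assms(1)], of 0] by simp

lemma sublinear_on_ge_uminus:
  assumes "function_space V" "sublinear_on V q" "f \<in> V"
  shows "q f \<ge> - q (\<lambda>x. - f x)"
  using sublinear_onD(1)[OF assms(2) assms(3) function_spaceD(3)[OF assms(1,3)]]
    sublinear_on_zero[OF assms(1,2)] by simp

text \<open>Lowering a sublinear functional to be additive in the direction \<open>k\<close>.\<close>

definition lower_along :: "('b \<Rightarrow> real) \<Rightarrow> (('b \<Rightarrow> real) \<Rightarrow> real) \<Rightarrow> ('b \<Rightarrow> real) \<Rightarrow> real" where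
  "lower_along k q f = (INF t\<in>{0..}. q (\<lambda>x. f x + t * k x) - t * q k)"

text \<open>Taking \<open>t = 0\<close> bounds the infimum by \<open>q f\<close>, and
  \<open>t = 1\<close> at \<open>- k\<close> bounds it by \<open>- q k\<close>. Sublinearity
  survives because the parameters \<open>s\<close> and \<open>t\<close> of two summands add up to
  the admissible parameter \<open>s + t\<close>, and scaling by \<open>c > 0\<close> rescales the
  parameter \<open>s\<close> to \<open>c * s\<close>.\<close>

lemma
  assumes V: "function_space V" and q: "sublinear_on V q" and k: "k \<in> V"
  shows lower_along_le: "f \<in> V \<Longrightarrow> lower_along k q f \<le> q f"
    and lower_along_uminus: "lower_along k q (\<lambda>x. - k x) \<le> - q k"
    and sublinear_on_lower_along: "sublinear_on V (lower_along k q)"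
proof -
  note VD = function_spaceD[OF V] and qD = sublinear_onD[OF q]
  \<comment> \<open>Subadditivity for \<open>t k = (f + t k) + (- f)\<close> keeps the infimum
    finite.\<close>
  have lb: "q (\<lambda>x. f x + t * k x) - t * q k \<ge> - q (\<lambda>x. - f x)" if f: "f \<in> V" and t: "t \<ge> 0" for f t
    using qD(1)[of "\<lambda>x. f x + t * k x" "\<lambda>x. - f x"] qD(2)[OF k t] VD f k by simp
  have bdd: "bdd_below ((\<lambda>t. q (\<lambda>x. f x + t * k x) - t * q k) ` {0..})" if "f \<in> V" for f
    using lb[OF that] by (intro bdd_belowI2[where m = "- q (\<lambda>x. - f x)"]) auto
  have shift: "lower_along k q f \<le> q (\<lambda>x. f x + t * k x) - t * q k" if "f \<in> V" "t \<ge> 0" for f t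
    unfolding lower_along_def using that by (intro cINF_lower[OF bdd]) auto
  show "lower_along k q f \<le> q f" if "f \<in> V" for f
    using shift[OF that, of 0] by simp
  show "lower_along k q (\<lambda>x. - k x) \<le> - q k"
    using shift[OF VD(3)[OF k], of 1] sublinear_on_zero[OF V q] by simp
  have greatest: "c \<le> lower_along k q f" if "\<And>t. t \<ge> 0 \<Longrightarrow> c \<le> q (\<lambda>x. f x + t * k x) - t * q k" for c f
    unfolding lower_along_def using that by (intro cINF_greatest) auto
  have add: "lower_along k q (\<lambda>x. f x + g x) \<le> lower_along k q f + lower_along k q g"
    if f: "f \<in> V" and g: "g \<in> V" for f g
  proof -
    have *: "lower_along k q (\<lambda>x. f x + g x) \<le> (q (\<lambda>x. f x + s * k x) - s * q k) + (q (\<lambda>x. g x + t * k x) - t * q k)"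
      if "s \<ge> 0" "t \<ge> 0" for s t
    proof -
      have "lower_along k q (\<lambda>x. f x + g x) \<le> q (\<lambda>x. (f x + g x) + (s + t) * k x) - (s + t) * q k"
        using that by (intro shift VD(1) f g) auto
      also have "q (\<lambda>x. (f x + g x) + (s + t) * k x) = q (\<lambda>x. (f x + s * k x) + (g x + t * k x))"
        by (simp add: algebra_simps)
      also have "\<dots> \<le> q (\<lambda>x. f x + s * k x) + q (\<lambda>x. g x + t * k x)"
        by (intro qD(1) VD(1) VD(2) f g k)
      finally show ?thesis by (simp add: algebra_simps)
    qed
    have "lower_along k q (\<lambda>x. f x + g x) - lower_along k q g \<le> q (\<lambda>x. f x + s * k x) - s * q k" if "s \<ge> 0" for s
    proof -
      have "lower_along k q (\<lambda>x. f x + g x) - (q (\<lambda>x. f x + s * k x) - s * q k) \<le> lower_along k q g"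
        using *[OF that] by (intro greatest) (simp add: algebra_simps)
      then show ?thesis by simp
    qed
    then have "lower_along k q (\<lambda>x. f x + g x) - lower_along k q g \<le> lower_along k q f"
      by (intro greatest)
    then show ?thesis by simp
  qed
  have le: "lower_along k q (\<lambda>x. c * f x) \<le> c * lower_along k q f" if f: "f \<in> V" and c: "c > 0" for f c
  proof -
    have "lower_along k q (\<lambda>x. c * f x) / c \<le> q (\<lambda>x. f x + s * k x) - s * q k" if s: "s \<ge> 0" for s
    proof -
      have "lower_along k q (\<lambda>x. c * f x) \<le> q (\<lambda>x. c * f x + (c * s) * k x) - (c * s) * q k"
        using s c by (intro shift VD f) auto
      also have "q (\<lambda>x. c * f x + (c * s) * k x) = q (\<lambda>x. c * (f x + s * k x))"
        by (simp add: algebra_simps)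
      also have "\<dots> = c * q (\<lambda>x. f x + s * k x)"
        using c by (intro qD(2) VD f k) auto
      finally show ?thesis using c by (simp add: field_simps)
    qed
    then have "lower_along k q (\<lambda>x. c * f x) / c \<le> lower_along k q f" by (intro greatest)
    then show ?thesis using c by (simp add: field_simps)
  qed
  have zero: "lower_along k q (\<lambda>x. 0) = 0"
  proof (rule antisym)
    show "lower_along k q (\<lambda>x. 0) \<le> 0"
      using shift[OF VD(4), of 0] sublinear_on_zero[OF V q] by simp
    show "0 \<le> lower_along k q (\<lambda>x. 0)"
      by (rule greatest) (use qD(2)[OF k] in simp)
  qed
  have "lower_along k q (\<lambda>x. c * f x) = c * lower_along k q f" if f: "f \<in> V" and c: "c \<ge> 0" for f c
  proof (cases "c = 0")
    case True then show ?thesis using zero by simp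
  next
    case False
    then have c: "c > 0" using c by simp
    \<comment> \<open>The reverse inequality is \<open>le\<close> itself, applied to
      \<open>c * f\<close> with the factor \<open>1 / c\<close>.\<close>
    have "lower_along k q f \<le> (1/c) * lower_along k q (\<lambda>x. c * f x)"
      using le[of "\<lambda>x. c * f x" "1/c"] VD(2)[OF f] c by simp
    then show ?thesis using le[OF f c] c by (simp add: field_simps)
  qed
  then show "sublinear_on V (lower_along k q)"
    using add by (auto simp: sublinear_on_def)
qed

text \<open>Provides lower bounds of chains for Zorn's lemma. The chain condition serves
  subadditivity: the smaller of two members \<open>q\<close> and \<open>r\<close> is at most
  \<open>q\<close> at \<open>f\<close> and at most \<open>r\<close> at \<open>g\<close>, so its own
  subadditivity bounds the infimum at \<open>f + g\<close> by \<open>q f + r g\<close>.\<close>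

lemma sublinear_on_INF_chain:
  assumes V: "function_space V" and C: "C \<noteq> {}" "\<And>q. q \<in> C \<Longrightarrow> sublinear_on V q"
    and bdd: "\<And>f. f \<in> V \<Longrightarrow> bdd_below ((\<lambda>q. q f) ` C)"
    and chain: "\<And>q r. q \<in> C \<Longrightarrow> r \<in> C \<Longrightarrow> (\<forall>f\<in>V. q f \<le> r f) \<or> (\<forall>f\<in>V. r f \<le> q f)"
  shows "sublinear_on V (\<lambda>f. INF q\<in>C. q f)"
proof -
  note VD = function_spaceD[OF V]
  define I where "I f = (INF q\<in>C. q f)" for f
  have low: "I f \<le> q f" if "f \<in> V" "q \<in> C" for f q
    unfolding I_def using that by (intro cINF_lower bdd)
  have gr: "c \<le> I f" if "\<And>q. q \<in> C \<Longrightarrow> c \<le> q f" for c f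
    unfolding I_def using that C(1) by (intro cINF_greatest) auto
  have "I (\<lambda>x. f x + g x) \<le> I f + I g" if f: "f \<in> V" and g: "g \<in> V" for f g
  proof -
    have *: "I (\<lambda>x. f x + g x) \<le> q f + r g" if q: "q \<in> C" and r: "r \<in> C" for q r
    proof -
      obtain s where s: "s \<in> C" "s f \<le> q f" "s g \<le> r g"
        using chain[OF q r] f g q r by blast
      have "I (\<lambda>x. f x + g x) \<le> s (\<lambda>x. f x + g x)" using s f g by (intro low VD)
      also have "\<dots> \<le> s f + s g" using sublinear_onD(1)[OF C(2)[OF s(1)]] f g by blast
      finally show ?thesis using s by linarith
    qed
    have "I (\<lambda>x. f x + g x) - q f \<le> I g" if "q \<in> C" for q
      by (rule gr) (use *[OF that] in \<open>simp add: algebra_simps\<close>)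
    then have "I (\<lambda>x. f x + g x) - I g \<le> I f"
      by (intro gr) (simp add: algebra_simps)
    then show ?thesis by simp
  qed
  moreover have "I (\<lambda>x. c * f x) = c * I f" if f: "f \<in> V" and c: "c \<ge> 0" for f c
  proof (cases "c = 0")
    case True
    have "I (\<lambda>x. 0) = 0"
    proof -
      have "(\<lambda>q. q (\<lambda>x. 0)) ` C = {0}"
        using sublinear_on_zero[OF V C(2)] C(1) by (force simp: image_def)
      then show ?thesis by (simp add: I_def)
    qed
    then show ?thesis using True by simp
  next
    case False
    then have c: "c > 0" using c by simp
    have hom: "q (\<lambda>x. c * f x) = c * q f" if "q \<in> C" for q
      using sublinear_onD(2)[OF C(2)[OF that] f] c by simp
    show ?thesis
    proof (rule antisym)
      have "I (\<lambda>x. c * f x) / c \<le> I f"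
        by (rule gr) (use hom low[OF VD(2)[OF f]] c in \<open>fastforce simp: field_simps\<close>)
      then show "I (\<lambda>x. c * f x) \<le> c * I f" using c by (simp add: field_simps)
      show "c * I f \<le> I (\<lambda>x. c * f x)"
      proof (rule gr)
        fix q assume "q \<in> C"
        then show "c * I f \<le> q (\<lambda>x. c * f x)"
          using hom[of q] mult_left_mono[OF low[OF f, of q], of c] c by simp
      qed
    qed
  qed
  ultimately show ?thesis unfolding sublinear_on_def I_def by blast
qed

lemma sublinear_on_cong:
  assumes "function_space V" "sublinear_on V q" "\<And>f. f \<in> V \<Longrightarrow> q f = r f"
  shows "sublinear_on V r"
proof -
  note VD = function_spaceD[OF assms(1)] and qD = sublinear_onD[OF assms(2)]
  show ?thesis unfolding sublinear_on_def
    using VD qD assms(3) by (metis (no_types, lifting))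
qed

text \<open>A minimal sublinear functional is linear, since lowering it along any direction changes nothing.\<close>

lemma exists_linear_le_sublinear:
  assumes V: "function_space V" and p: "sublinear_on V p"
  obtains L where "linear_functional_on V L" "\<And>f. f \<in> V \<Longrightarrow> L f \<le> p f"
proof -
  note VD = function_spaceD[OF V]
  \<comment> \<open>Extensionality freezes the values outside \<open>V\<close>, so that functionals
    agreeing on \<open>V\<close> are equal and \<open>P\<close> is antisymmetric.\<close>
  define A where "A = {q. sublinear_on V q \<and> (\<forall>f\<in>V. q f \<le> p f) \<and> q \<in> extensional V}"
  \<comment> \<open>The order is reversed: a \<open>P\<close>-maximal element is a pointwise minimal
    functional.\<close>
  define P where "P = (\<lambda>q r. \<forall>f\<in>V. (r :: ('a \<Rightarrow> real) \<Rightarrow> real) f \<le> q f)"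
  have restr: "restrict q V \<in> A" if "sublinear_on V q" "\<And>f. f \<in> V \<Longrightarrow> q f \<le> p f" for q
    using that sublinear_on_cong[OF V that(1), of "restrict q V"] by (auto simp: A_def)
  have "\<exists>m\<in>A. \<forall>a\<in>A. P m a \<longrightarrow> a = m"
  proof (rule predicate_Zorn)
    show "partial_order_on A (relation_of P A)"
      unfolding partial_order_on_def preorder_on_def
    proof (intro conjI)
      show "refl_on A (relation_of P A)" by (auto simp: refl_on_def relation_of_def P_def)
      show "relation_of P A \<subseteq> A \<times> A" by (auto simp: relation_of_def)
      show "trans (relation_of P A)" by (rule transI) (force simp: relation_of_def P_def)
      show "antisym (relation_of P A)"
        by (rule antisymI) (fastforce simp: relation_of_def P_def A_def intro!: extensionalityI[of _ V] intro: order.antisym)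
    qed
    fix C assume C: "C \<in> Chains (relation_of P A)"
    show "\<exists>u\<in>A. \<forall>a\<in>C. P a u"
    proof (cases "C = {}")
      case True
      then show ?thesis using restr[OF p] by auto
    next
      case False
      have CA: "C \<subseteq> A" using C False by (fastforce simp: Chains_def relation_of_def)
      have bdd: "bdd_below ((\<lambda>q. q f) ` C)" if f: "f \<in> V" for f
      proof (rule bdd_belowI2)
        fix q assume "q \<in> C"
        then have q: "sublinear_on V q" "\<forall>f\<in>V. q f \<le> p f" using CA by (auto simp: A_def)
        \<comment> \<open>Since \<open>q\<close> lies below \<open>p\<close>, one has
          \<open>- p (- f) \<le> - q (- f) \<le> q f\<close>, a bound independent of
          \<open>q\<close>.\<close>
        show "- p (\<lambda>x. - f x) \<le> q f"
          using sublinear_on_ge_uminus[OF V q(1) f] q(2) VD(3)[OF f] by fastforce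
      qed
      have "sublinear_on V (\<lambda>f. INF q\<in>C. q f)"
      proof (rule sublinear_on_INF_chain[OF V False _ bdd])
        show "sublinear_on V q" if "q \<in> C" for q using that CA by (auto simp: A_def)
        show "(\<forall>f\<in>V. q f \<le> r f) \<or> (\<forall>f\<in>V. r f \<le> q f)" if "q \<in> C" "r \<in> C" for q r
          using C that by (auto simp: Chains_def relation_of_def P_def)
      qed
      moreover have le: "(INF q\<in>C. q f) \<le> q f" if "q \<in> C" "f \<in> V" for q f
        using that by (intro cINF_lower bdd)
      moreover have "(INF q\<in>C. q f) \<le> p f" if "f \<in> V" for f
      proof -
        obtain q where q: "q \<in> C" using False by auto
        then have "q f \<le> p f" using CA that by (auto simp: A_def)
        then show ?thesis using le[OF q that] by linarith
      qed
      ultimately have "restrict (\<lambda>f. INF q\<in>C. q f) V \<in> A" by (intro restr)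
      moreover have "P q (restrict (\<lambda>f. INF q\<in>C. q f) V)" if "q \<in> C" for q
        using le[OF that] by (simp add: P_def)
      ultimately show ?thesis by blast
    qed
  qed
  then obtain m where m: "m \<in> A" and min: "\<And>a. a \<in> A \<Longrightarrow> P m a \<Longrightarrow> a = m" by blast
  have sm: "sublinear_on V m" and mp: "\<And>f. f \<in> V \<Longrightarrow> m f \<le> p f" using m by (auto simp: A_def)
  note mD = sublinear_onD[OF sm]
  have odd: "m (\<lambda>x. - k x) = - m k" if k: "k \<in> V" for k
  proof (rule antisym)
    have "restrict (lower_along k m) V \<in> A"
      using lower_along_le[OF V sm k] mp by (intro restr sublinear_on_lower_along[OF V sm k]) force
    moreover have "P m (restrict (lower_along k m) V)"
      using lower_along_le[OF V sm k] by (auto simp: P_def)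
    ultimately have "restrict (lower_along k m) V = m" by (rule min)
    then have "lower_along k m (\<lambda>x. - k x) = m (\<lambda>x. - k x)" using VD(3)[OF k] by (metis restrict_apply')
    then show "m (\<lambda>x. - k x) \<le> - m k" using lower_along_uminus[OF V sm k] by simp
    show "- m k \<le> m (\<lambda>x. - k x)"
      using sublinear_on_ge_uminus[OF V sm VD(3)[OF k]] by simp
  qed
  have "m (\<lambda>x. f x + g x) = m f + m g" if f: "f \<in> V" and g: "g \<in> V" for f g
  proof (rule antisym)
    show "m (\<lambda>x. f x + g x) \<le> m f + m g" by (rule mD(1)[OF f g])
    \<comment> \<open>Superadditivity is subadditivity at the negated arguments, turned around by
      \<open>odd\<close>.\<close>
    have "m (\<lambda>x. - (f x + g x)) \<le> m (\<lambda>x. - f x) + m (\<lambda>x. - g x)"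
      using mD(1)[OF VD(3)[OF f] VD(3)[OF g]] by (simp add: algebra_simps)
    then show "m f + m g \<le> m (\<lambda>x. f x + g x)"
      using odd[OF VD(1)[OF f g]] odd[OF f] odd[OF g] by linarith
  qed
  moreover have "m (\<lambda>x. c * f x) = c * m f" if f: "f \<in> V" for f c
  proof (cases "c \<ge> 0")
    case True then show ?thesis by (rule mD(2)[OF f])
  next
    case False
    then have "m (\<lambda>x. (- c) * f x) = (- c) * m f" by (intro mD(2)[OF f]) auto
    then show ?thesis using odd[OF VD(2)[OF f, of c]] by simp
  qed
  ultimately have "linear_functional_on V m" by (auto simp: linear_functional_on_def)
  then show ?thesis using mp that by blast
qed

text \<open>Domination by \<open>lower_along k p\<close> instead of \<open>p\<close> pins the value
  at \<open>k\<close>: it forces \<open>L (- k) \<le> - p k\<close>, hence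
  \<open>p k \<le> L k\<close>.\<close>

theorem exists_linear_le_sublinear_attaining:
  assumes V: "function_space V" and p: "sublinear_on V p" and k: "k \<in> V"
  obtains L where "linear_functional_on V L" "\<And>f. f \<in> V \<Longrightarrow> L f \<le> p f" "L k = p k"
proof -
  obtain L where L: "linear_functional_on V L" and le: "\<And>f. f \<in> V \<Longrightarrow> L f \<le> lower_along k p f"
    using exists_linear_le_sublinear[OF V sublinear_on_lower_along[OF V p k]] by blast
  have Lp: "L f \<le> p f" if "f \<in> V" for f
    using le[OF that] lower_along_le[OF V p k that] by linarith
  have "L (\<lambda>x. - k x) = - L k"
    using L k unfolding linear_functional_on_def by (metis (no_types, lifting) mult_minus1 ext)
  then have "p k \<le> L k"
    using le[OF function_spaceD(3)[OF V k]] lower_along_uminus[OF V p k] by linarith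
  then show ?thesis using that[OF L Lp] Lp[OF k] by linarith
qed

section \<open>The Riesz representation theorem on compact Hausdorff spaces\<close>

definition cfuns :: "'b topology \<Rightarrow> ('b \<Rightarrow> real) set" where
  "cfuns X = {f. continuous_map X euclideanreal f}"

lemma function_space_cfuns: "function_space (cfuns X)"
  by (auto simp: function_space_def cfuns_def intro!: continuous_intros exI[of _ "\<lambda>_. 0"])

lemma space_borel_of [simp]: "space (borel_of X) = topspace X"
  by (simp add: borel_of_def space_measure_of_conv)

lemma sets_borel_of: "sets (borel_of X) = sigma_sets (topspace X) {U. openin X U}"
  unfolding borel_of_def by (rule sets_measure_of) (auto dest: openin_subset)

lemma openin_borel_of: "openin X U \<Longrightarrow> U \<in> sets (borel_of X)"
  by (auto simp: sets_borel_of)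

lemma closedin_borel_of: "closedin X U \<Longrightarrow> U \<in> sets (borel_of X)"
  using sets.compl_sets[OF openin_borel_of[of X "topspace X - U"]]
  by (simp add: closedin_def double_diff)

lemma continuous_map_measurable:
  assumes "sets M = sets (borel_of X)" "continuous_map X euclidean f"
  shows "f \<in> borel_measurable M"
proof (rule borel_measurableI)
  fix S :: "'b set" assume S: "open S"
  have "space M = topspace X" using sets_eq_imp_space_eq[OF assms(1)] by simp
  then have "f -` S \<inter> space M = {x \<in> topspace X. f x \<in> S}" by auto
  moreover have "openin X {x \<in> topspace X. f x \<in> S}"
    using openin_continuous_map_preimage[OF assms(2)] S by simp
  ultimately show "f -` S \<inter> space M \<in> sets M" using openin_borel_of assms(1) by simp
qed

lemma compact_space_bounded_cfuns:
  assumes "compact_space X" "f \<in> cfuns X"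
  shows "\<exists>B. \<forall>x\<in>topspace X. \<bar>f x\<bar> \<le> B"
proof -
  have "compact (f ` topspace X)"
    using image_compactin[of X "topspace X" euclideanreal f] assms
    by (simp add: compact_space_def cfuns_def)
  from compact_imp_bounded[OF this] obtain B where "\<forall>y \<in> f ` topspace X. norm y \<le> B"
    unfolding bounded_iff by (elim exE)
  then show ?thesis by auto
qed

lemma cfuns_integrable:
  assumes "compact_space X" "sets M = sets (borel_of X)" "emeasure M (space M) < \<infinity>" "f \<in> cfuns X"
  shows "integrable M f"
proof -
  obtain B where B: "\<forall>x\<in>topspace X. \<bar>f x\<bar> \<le> B"
    using compact_space_bounded_cfuns[OF assms(1,4)] by auto
  interpret finite_measure M
    by (rule finite_measureI) (use assms(3) in \<open>simp add: less_top\<close>)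
  have "space M = topspace X" using sets_eq_imp_space_eq[OF assms(2)] by simp
  then show ?thesis
    using B assms(4) continuous_map_measurable[OF assms(2), of f]
    by (intro integrable_const_bound[where B = B] AE_I2) (simp_all add: cfuns_def)
qed

section \<open>Contents of open sets\<close>

locale positive_functional =
  fixes X :: "'b topology" and L :: "('b \<Rightarrow> real) \<Rightarrow> real"
  assumes compact: "compact_space X" and Hausdorff: "Hausdorff_space X"
    and linear: "linear_functional_on (cfuns X) L"
    and pos: "\<And>f. f \<in> cfuns X \<Longrightarrow> (\<And>x. x \<in> topspace X \<Longrightarrow> 0 \<le> f x) \<Longrightarrow> 0 \<le> L f"
begin

lemma const_cfuns [simp]: "(\<lambda>x. c) \<in> cfuns X"
  by (simp add: cfuns_def)

lemma add: "f \<in> cfuns X \<Longrightarrow> g \<in> cfuns X \<Longrightarrow> L (\<lambda>x. f x + g x) = L f + L g"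
  using linear by (simp add: linear_functional_on_def)

lemma scale: "f \<in> cfuns X \<Longrightarrow> L (\<lambda>x. c * f x) = c * L f"
  using linear by (simp add: linear_functional_on_def)

lemma zero: "L (\<lambda>x. 0) = 0"
  using scale[of "\<lambda>x. 0" 0] by simp

lemma sum:
  assumes "\<And>i. i < (n::nat) \<Longrightarrow> f i \<in> cfuns X"
  shows "(\<lambda>x. \<Sum>i<n. f i x) \<in> cfuns X \<and> L (\<lambda>x. \<Sum>i<n. f i x) = (\<Sum>i<n. L (f i))"
  using assms
proof (induction n)
  case 0 then show ?case by (simp add: zero)
next
  case (Suc n)
  then have "(\<lambda>x. \<Sum>i<n. f i x) \<in> cfuns X" "L (\<lambda>x. \<Sum>i<n. f i x) = (\<Sum>i<n. L (f i))" "f n \<in> cfuns X"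
    by auto
  then show ?case
    using add[of "\<lambda>x. \<Sum>i<n. f i x" "f n"] function_spaceD(1)[OF function_space_cfuns] by simp
qed

lemma mono:
  assumes "f \<in> cfuns X" "g \<in> cfuns X" "\<And>x. x \<in> topspace X \<Longrightarrow> f x \<le> g x"
  shows "L f \<le> L g"
proof -
  have "(\<lambda>x. (-1) * f x) \<in> cfuns X" using function_spaceD(2)[OF function_space_cfuns assms(1)] .
  moreover have "(\<lambda>x. g x + (-1) * f x) \<in> cfuns X"
    using function_spaceD(1)[OF function_space_cfuns assms(2) calculation] .
  then have "0 \<le> L (\<lambda>x. g x + (-1) * f x)" using assms(3) by (intro pos) auto
  ultimately show ?thesis using add[OF assms(2), of "\<lambda>x. (-1) * f x"] scale[OF assms(1), of "-1"] by simp
qed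

text \<open>Vanishing off \<open>U\<close> replaces the usual condition that the support lie in
  \<open>U\<close>; \<open>truncate_below\<close> recovers the compact carrier when one is
  needed.\<close>

definition below :: "'b set \<Rightarrow> ('b \<Rightarrow> real) set" where
  "below U = {f \<in> cfuns X. (\<forall>x\<in>topspace X. 0 \<le> f x \<and> f x \<le> 1) \<and> (\<forall>x\<in>topspace X - U. f x = 0)}"

definition content :: "'b set \<Rightarrow> real" where
  "content U = (SUP f\<in>below U. L f)"

text \<open>Meaningful for \<open>E\<close> inside the space, which is then itself an open superset;
  for other \<open>E\<close> the infimum ranges over the empty set.\<close>

definition outer :: "'b set \<Rightarrow> real" where
  "outer E = (INF U\<in>{U. openin X U \<and> E \<subseteq> U}. content U)"

lemma belowD:
  assumes "f \<in> below U"
  shows "f \<in> cfuns X" "x \<in> topspace X \<Longrightarrow> 0 \<le> f x" "x \<in> topspace X \<Longrightarrow> f x \<le> 1"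
    "x \<in> topspace X \<Longrightarrow> x \<notin> U \<Longrightarrow> f x = 0"
  using assms by (auto simp: below_def)

lemma zero_below: "(\<lambda>x. 0) \<in> below U" by (simp add: below_def)

lemma total_nonneg: "0 \<le> L (\<lambda>x. 1)" by (rule pos) auto

lemma below_le: "f \<in> below U \<Longrightarrow> L f \<le> content U"
  unfolding content_def
  by (intro cSUP_upper bdd_aboveI2[where M = "L (\<lambda>x. 1)"] mono) (auto dest: belowD)

lemma content_least: "(\<And>f. f \<in> below U \<Longrightarrow> L f \<le> c) \<Longrightarrow> content U \<le> c"
  unfolding content_def using zero_below[of U] by (intro cSUP_least) auto

lemma content_nonneg: "0 \<le> content U"
  using below_le[OF zero_below, of U] zero by simp

lemma content_mono: "U \<subseteq> V \<Longrightarrow> content U \<le> content V"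
  by (intro content_least below_le) (auto simp: below_def)

lemma content_empty: "content {} = 0"
proof (rule antisym)
  show "content {} \<le> 0"
  proof (rule content_least)
    fix f assume "f \<in> below {}"
    then have "L f \<le> L (\<lambda>x. 0)" by (intro mono) (auto simp: below_def)
    then show "L f \<le> 0" by (simp add: zero)
  qed
qed (rule content_nonneg)

lemma content_le_total: "content U \<le> L (\<lambda>x. 1)"
  by (intro content_least mono) (auto dest: belowD)

lemma content_topspace: "content (topspace X) = L (\<lambda>x. 1)"
  using content_le_total below_le[of "\<lambda>x. 1" "topspace X"] by (intro antisym) (auto simp: below_def)

text \<open>Cutting off the bottom layer, \<open>h = max (f - r) 0\<close>, costs at most
  \<open>r * L 1\<close> and leaves a function carried by the closed, hence compact, set
  \<open>{r \<le> f}\<close>, which lies in \<open>U\<close> because \<open>f\<close> vanishes off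
  \<open>U\<close>.\<close>

lemma truncate_below:
  assumes f: "f \<in> below U" and e: "e > 0"
  obtains h r where "r > 0" "h \<in> below U" "L f \<le> L h + e" "closedin X {x \<in> topspace X. r \<le> f x}"
    "\<And>x. x \<in> topspace X \<Longrightarrow> f x < r \<Longrightarrow> h x = 0"
proof -
  \<comment> \<open>Adding 1 keeps the denominator positive when \<open>L 1 = 0\<close>.\<close>
  define r where "r = e / (L (\<lambda>x. 1) + 1)"
  have r: "r > 0" using e total_nonneg by (simp add: r_def)
  define h where "h = (\<lambda>x. max (f x - r) 0)"
  have fc: "continuous_map X euclideanreal f" using belowD(1)[OF f] by (simp add: cfuns_def)
  have hc: "h \<in> cfuns X"
    unfolding h_def cfuns_def using fc by (simp add: continuous_intros)
  show ?thesis
  proof (rule that)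
    show "h \<in> below U"
      using hc belowD(2-)[OF f] r by (fastforce simp: below_def h_def)
    have "L f \<le> L (\<lambda>x. h x + r * 1)"
      using function_spaceD(1)[OF function_space_cfuns hc, of "\<lambda>x. r"]
      by (intro mono belowD(1)[OF f]) (auto simp: h_def)
    also have "\<dots> = L h + r * L (\<lambda>x. 1)"
      using add[OF hc, of "\<lambda>x. r * 1"] scale[of "\<lambda>x. 1" r] by simp
    also have "r * L (\<lambda>x. 1) \<le> e" using e total_nonneg by (simp add: r_def field_simps)
    finally show "L f \<le> L h + e" by simp
    have "closedin X {x \<in> topspace X. f x \<in> {r..}}"
      by (rule closedin_continuous_map_preimage[OF fc]) simp
    then show "closedin X {x \<in> topspace X. r \<le> f x}" by simp
    show "h x = 0" if "f x < r" for x using that by (simp add: h_def)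
  qed (rule r)
qed

text \<open>The parts of the carrier of \<open>h\<close> outside \<open>U\<close> and outside
  \<open>V\<close> are disjoint closed sets. A Urysohn function \<open>w\<close>, equal to 0 on the
  first and 1 on the second, splits \<open>h\<close> into \<open>h w\<close>, which vanishes off
  \<open>U\<close>, and \<open>h (1 - w)\<close>, which vanishes off \<open>V\<close>.\<close>

lemma content_Un:
  assumes U: "openin X U" and V: "openin X V"
  shows "content (U \<union> V) \<le> content U + content V"
proof (rule content_least)
  fix f assume f: "f \<in> below (U \<union> V)"
  show "L f \<le> content U + content V"
  proof (rule field_le_epsilon)
    fix e :: real assume e: "e > 0"
    obtain h r where h: "r > 0" "h \<in> below (U \<union> V)" "L f \<le> L h + e"
      and K: "closedin X {x \<in> topspace X. r \<le> f x}" and h0: "\<And>x. x \<in> topspace X \<Longrightarrow> f x < r \<Longrightarrow> h x = 0"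
      using truncate_below[OF f e] by blast
    let ?K = "{x \<in> topspace X. r \<le> f x}"
    have "disjnt (?K - U) (?K - V)"
      using belowD(4)[OF f] h(1) by (force simp: disjnt_iff)
    moreover have "closedin X (?K - U)" "closedin X (?K - V)"
      using closedin_diff[OF K] U V by auto
    ultimately obtain w where w: "continuous_map X (top_of_set {0..1::real}) w"
      "w ` (?K - U) \<subseteq> {0}" "w ` (?K - V) \<subseteq> {1}"
      using Urysohn_lemma[OF compact_Hausdorff_or_regular_imp_normal_space, of X "?K - U" "?K - V" 0 1]
        compact Hausdorff by auto
    have wc: "continuous_map X euclideanreal w" and w01: "\<And>x. x \<in> topspace X \<Longrightarrow> 0 \<le> w x \<and> w x \<le> 1"
      using w(1) by (auto simp: continuous_map_in_subtopology)
    have hc: "continuous_map X euclideanreal h" using belowD(1)[OF h(2)] by (simp add: cfuns_def)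
    have 1: "(\<lambda>x. h x * w x) \<in> below U"
    proof -
      have "h x * w x = 0" if "x \<in> topspace X" "x \<notin> U" for x
        using that w(2) h0[of x] by (cases "f x < r") (auto simp: image_subset_iff not_less)
      then show ?thesis
        using belowD(2,3)[OF h(2)] w01 hc wc
        by (auto simp: below_def cfuns_def intro!: continuous_intros mult_le_one)
    qed
    have 2: "(\<lambda>x. h x * (1 - w x)) \<in> below V"
    proof -
      have "h x * (1 - w x) = 0" if "x \<in> topspace X" "x \<notin> V" for x
        using that w(3) h0[of x] by (cases "f x < r") (auto simp: image_subset_iff not_less)
      then show ?thesis
        using belowD(2,3)[OF h(2)] w01 hc wc
        by (auto simp: below_def cfuns_def intro!: continuous_intros mult_le_one)
    qed
    have "L h = L (\<lambda>x. h x * w x) + L (\<lambda>x. h x * (1 - w x))"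
      using add[OF belowD(1)[OF 1] belowD(1)[OF 2]] by (simp add: algebra_simps)
    then show "L f \<le> content U + content V + e"
      using below_le[OF 1] below_le[OF 2] h(3) by linarith
  qed
qed

lemma content_UN_finite:
  assumes "finite I" "\<And>i. i \<in> I \<Longrightarrow> openin X (U i)"
  shows "content (\<Union>i\<in>I. U i) \<le> (\<Sum>i\<in>I. content (U i))"
  using assms
proof (induction I)
  case empty then show ?case by (simp add: content_empty)
next
  case (insert j I)
  then show ?case
    using content_Un[of "U j" "\<Union>i\<in>I. U i"] by fastforce
qed

text \<open>After truncation the carrier is compact, so finitely many \<open>U i\<close> cover it
  and finite subadditivity applies. Extended reals admit a divergent series on the right.\<close>

lemma content_UN:
  fixes U :: "nat \<Rightarrow> 'b set"
  assumes U: "\<And>i. openin X (U i)"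
  shows "ennreal (content (\<Union>i. U i)) \<le> (\<Sum>i. ennreal (content (U i)))"
proof (cases "(\<Sum>i. ennreal (content (U i))) = top")
  case False
  then obtain s where s: "s \<ge> 0" "(\<Sum>i. ennreal (content (U i))) = ennreal s"
    by (metis ennreal_cases)
  have "content (\<Union>i. U i) \<le> s"
  proof (rule content_least)
    fix f assume f: "f \<in> below (\<Union>i. U i)"
    show "L f \<le> s"
    proof (rule field_le_epsilon)
      fix e :: real assume e: "e > 0"
      obtain h r where h: "r > 0" "h \<in> below (\<Union>i. U i)" "L f \<le> L h + e"
        and K: "closedin X {x \<in> topspace X. r \<le> f x}" and h0: "\<And>x. x \<in> topspace X \<Longrightarrow> f x < r \<Longrightarrow> h x = 0"
        using truncate_below[OF f e] by blast
      let ?K = "{x \<in> topspace X. r \<le> f x}"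
      have "compactin X ?K" using closedin_compact_space[OF compact K] .
      moreover have "?K \<subseteq> \<Union> (range U)" using belowD(4)[OF f] h(1) by force
      ultimately obtain F where F: "finite F" "F \<subseteq> range U" "?K \<subseteq> \<Union> F"
        using compactinD[of X ?K "range U"] U by blast
      then obtain I where I: "finite I" "F = U ` I"
        by (metis finite_subset_image subset_UNIV)
      have "h \<in> below (\<Union>i\<in>I. U i)"
        using h(2) h0 F(3) I(2) unfolding below_def by (force simp: not_le)
      then have "L h \<le> (\<Sum>i\<in>I. content (U i))"
        using below_le content_UN_finite[OF I(1), of U] U by force
      moreover have "ennreal (\<Sum>i\<in>I. content (U i)) \<le> (\<Sum>i. ennreal (content (U i)))"
        unfolding sum_ennreal[OF content_nonneg, symmetric] by (intro sum_le_suminf summableI I(1)) simp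
      then have "(\<Sum>i\<in>I. content (U i)) \<le> s" using s by (simp add: ennreal_le_iff)
      ultimately show "L f \<le> s + e" using h(3) by linarith
    qed
  qed
  then show ?thesis using s by (simp add: ennreal_leI)
qed simp

section \<open>The outer measure and its Caratheodory sets\<close>

lemma outer_le: "openin X U \<Longrightarrow> E \<subseteq> U \<Longrightarrow> outer E \<le> content U"
  unfolding outer_def by (intro cINF_lower bdd_belowI2[where m = 0] content_nonneg) auto

lemma outer_greatest:
  assumes "E \<subseteq> topspace X" "\<And>U. openin X U \<Longrightarrow> E \<subseteq> U \<Longrightarrow> c \<le> content U"
  shows "c \<le> outer E"
  unfolding outer_def using assms by (intro cINF_greatest) auto

lemma outer_approx:
  assumes "E \<subseteq> topspace X" "e > 0"
  obtains U where "openin X U" "E \<subseteq> U" "content U < outer E + e"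
  using outer_greatest[OF assms(1), of "outer E + e"] assms(2) by force

lemma outer_open: "openin X U \<Longrightarrow> outer U = content U"
  by (intro antisym outer_le outer_greatest content_mono) (auto dest: openin_subset)

lemma outer_nonneg: "E \<subseteq> topspace X \<Longrightarrow> 0 \<le> outer E"
  by (intro outer_greatest content_nonneg)

lemma outer_mono: "E \<subseteq> F \<Longrightarrow> F \<subseteq> topspace X \<Longrightarrow> outer E \<le> outer F"
  by (intro outer_greatest outer_le) auto

lemma outer_Un:
  assumes "E \<subseteq> topspace X" "F \<subseteq> topspace X"
  shows "outer (E \<union> F) \<le> outer E + outer F"
proof (rule field_le_epsilon)
  fix e :: real assume "e > 0"
  then have "e/2 > 0" by simp
  obtain U V where U: "openin X U" "E \<subseteq> U" "content U < outer E + e/2"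
    and V: "openin X V" "F \<subseteq> V" "content V < outer F + e/2"
    using outer_approx[OF assms(1) \<open>e/2 > 0\<close>] outer_approx[OF assms(2) \<open>e/2 > 0\<close>] by metis
  then have "outer (E \<union> F) \<le> content (U \<union> V)" by (intro outer_le) auto
  then show "outer (E \<union> F) \<le> outer E + outer F + e" using content_Un[OF U(1) V(1)] U V by linarith
qed

text \<open>Countable subadditivity passes from open sets to arbitrary ones by enclosing each
  \<open>A i\<close> in an open set of nearly the same outer measure.\<close>

lemma outer_measure_space_outer: "outer_measure_space (Pow (topspace X)) (\<lambda>E. ennreal (outer E))"
  unfolding outer_measure_space_def
proof (intro conjI)
  show "positive (Pow (topspace X)) (\<lambda>E. ennreal (outer E))"
    using outer_open[of "{}"] content_empty by (simp add: positive_def)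
  show "increasing (Pow (topspace X)) (\<lambda>E. ennreal (outer E))"
    by (auto simp: increasing_def intro!: ennreal_leI outer_mono)
  show "countably_subadditive (Pow (topspace X)) (\<lambda>E. ennreal (outer E))"
    unfolding countably_subadditive_def
  proof (intro allI impI)
    fix A :: "nat \<Rightarrow> 'b set" assume "range A \<subseteq> Pow (topspace X)"
    then have A: "A i \<subseteq> topspace X" for i by auto
    show "ennreal (outer (\<Union>i. A i)) \<le> (\<Sum>i. ennreal (outer (A i)))"
    proof (rule ennreal_le_epsilon)
      fix e :: real assume e: "0 < e"
      \<comment> \<open>The errors \<open>e / 2^(i+1)\<close> add up to \<open>e\<close>.\<close>
      have "\<exists>U. openin X U \<and> A i \<subseteq> U \<and> content U < outer (A i) + e * (1/2)^Suc i" for i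
        using outer_approx[OF A, of "e * (1/2)^Suc i"] e by (metis mult_pos_pos zero_less_divide_1_iff zero_less_numeral zero_less_power)
      then obtain U where U: "\<And>i. openin X (U i)" "\<And>i. A i \<subseteq> U i"
        "\<And>i. content (U i) < outer (A i) + e * (1/2)^Suc i" by metis
      have "ennreal (outer (\<Union>i. A i)) \<le> ennreal (content (\<Union>i. U i))"
        using U by (intro ennreal_leI outer_le) auto
      also have "\<dots> \<le> (\<Sum>i. ennreal (content (U i)))" by (rule content_UN[OF U(1)])
      also have "\<dots> \<le> (\<Sum>i. ennreal (outer (A i)) + ennreal (e * (1/2)^Suc i))"
        using U(3) e outer_nonneg[OF A] less_imp_le
        by (intro suminf_le summableI) (auto simp: ennreal_plus[symmetric] simp del: ennreal_plus power_Suc intro!: ennreal_leI)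
      also have "\<dots> = (\<Sum>i. ennreal (outer (A i))) + (\<Sum>i. ennreal (e * (1/2)^Suc i))"
        by (intro suminf_add[symmetric] summableI)
      also have "(\<Sum>i. ennreal (e * (1/2)^Suc i)) = ennreal e"
        using sums_mult[OF power_half_series, of e] e by (intro suminf_ennreal_eq) auto
      finally show "ennreal (outer (\<Union>i. A i)) \<le> (\<Sum>i. ennreal (outer (A i))) + ennreal e" .
    qed
  qed
qed

text \<open>Open sets satisfy Caratheodory's condition. Given an open \<open>V\<close> around
  \<open>E\<close>, a function below \<open>V \<inter> U\<close> is truncated to \<open>h\<close>
  with carrier \<open>?K\<close> inside \<open>U\<close>; every \<open>k\<close> below
  \<open>V - ?K\<close> can be added to \<open>h\<close> without leaving \<open>below V\<close>, and
  \<open>V - ?K\<close> still covers \<open>E - U\<close>.\<close>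

lemma outer_split_open:
  assumes U: "openin X U" and E: "E \<subseteq> topspace X"
  shows "outer (E \<inter> U) + outer (E - U) = outer E"
proof (rule antisym)
  show "outer E \<le> outer (E \<inter> U) + outer (E - U)"
    using outer_Un[of "E \<inter> U" "E - U"] E by (auto simp: Int_Diff_Un)
  show "outer (E \<inter> U) + outer (E - U) \<le> outer E"
  proof (rule outer_greatest[OF E])
    fix V assume V: "openin X V" "E \<subseteq> V"
    have VU: "openin X (V \<inter> U)" using U V by auto
    have "L f \<le> content V - outer (E - U)" if f: "f \<in> below (V \<inter> U)" for f
    proof (rule field_le_epsilon)
      fix e :: real assume e: "e > 0"
      obtain h r where h: "r > 0" "h \<in> below (V \<inter> U)" "L f \<le> L h + e"
        and K: "closedin X {x \<in> topspace X. r \<le> f x}" and h0: "\<And>x. x \<in> topspace X \<Longrightarrow> f x < r \<Longrightarrow> h x = 0"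
        using truncate_below[OF f e] by blast
      let ?K = "{x \<in> topspace X. r \<le> f x}"
      have KU: "?K \<subseteq> U" using belowD(4)[OF f] h(1) by force
      have W: "openin X (V - ?K)" using V K by auto
      have "content (V - ?K) \<le> content V - L h"
      proof (rule content_least)
        fix k assume k: "k \<in> below (V - ?K)"
        have "(\<lambda>x. h x + k x) \<in> below V"
        proof -
          \<comment> \<open>At every point one summand vanishes: \<open>h\<close> where
            \<open>f x < r\<close>, and \<open>k\<close> on \<open>?K\<close>.\<close>
          have "h x + k x \<le> 1" if "x \<in> topspace X" for x
            using that h0[of x] belowD(3,4)[OF k, of x] belowD(3)[OF h(2), of x] by (cases "f x < r") auto
          then show ?thesis
            using belowD(1,2,4)[OF h(2)] belowD(1,2,4)[OF k] function_spaceD(1)[OF function_space_cfuns]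
            by (auto simp: below_def)
        qed
        then show "L k \<le> content V - L h"
          using below_le add[OF belowD(1)[OF h(2)] belowD(1)[OF k]] by fastforce
      qed
      moreover have "outer (E - U) \<le> content (V - ?K)"
        using KU V by (intro outer_le W) auto
      ultimately show "L f \<le> content V - outer (E - U) + e" using h(3) by linarith
    qed
    then have "content (V \<inter> U) \<le> content V - outer (E - U)" by (rule content_least)
    moreover have "outer (E \<inter> U) \<le> content (V \<inter> U)" using V by (intro outer_le VU) auto
    ultimately show "outer (E \<inter> U) + outer (E - U) \<le> content V" by linarith
  qed
qed

section \<open>The representing measure and its regularity\<close>

definition riesz_measure :: "'b measure" where
  "riesz_measure = measure_of (topspace X) {U. openin X U} (\<lambda>E. ennreal (outer E))"

lemma sets_riesz_measure: "sets riesz_measure = sets (borel_of X)"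
  unfolding riesz_measure_def sets_borel_of
  by (rule sets_measure_of) (auto dest: openin_subset)

lemma space_riesz_measure: "space riesz_measure = topspace X"
  using sets_eq_imp_space_eq[OF sets_riesz_measure] by simp

text \<open>By Caratheodory's theorem the sets that split \<open>outer\<close> additively form a
  sigma-algebra on which it is a measure; containing the open sets, it contains all Borel
  sets.\<close>

lemma emeasure_riesz_measure:
  assumes "A \<in> sets (borel_of X)"
  shows "emeasure riesz_measure A = ennreal (outer A)"
proof -
  let ?\<Omega> = "topspace X" and ?f = "\<lambda>E. ennreal (outer E)"
  let ?S = "lambda_system ?\<Omega> (Pow ?\<Omega>) ?f"
  have ms: "measure_space ?\<Omega> ?S ?f"
    by (rule sigma_algebra.caratheodory_lemma[OF sigma_algebra_Pow outer_measure_space_outer])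
  have "{U. openin X U} \<subseteq> ?S"
    using outer_split_open outer_nonneg
    by (auto simp: algebra.lambda_system_eq[OF algebra_Pow] ennreal_plus[symmetric] openin_subset subset_iff
        simp del: ennreal_plus dest: openin_subset) 
  then have sub: "sigma_sets ?\<Omega> {U. openin X U} \<subseteq> ?S"
    using ms by (intro sigma_algebra.sigma_sets_subset) (auto simp: measure_space_def)
  show ?thesis
  proof (rule emeasure_measure_of[OF riesz_measure_def])
    show "{U. openin X U} \<subseteq> Pow ?\<Omega>" by (auto dest: openin_subset)
    show "positive (sets riesz_measure) ?f"
      using outer_open[of "{}"] content_empty by (simp add: positive_def)
    show "countably_additive (sets riesz_measure) ?f"
      using ms sub unfolding measure_space_def countably_additive_def sets_riesz_measure sets_borel_of
      by (meson subset_trans subsetD)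
    show "A \<in> sets riesz_measure" using assms by (simp add: sets_riesz_measure)
  qed
qed

lemma measure_riesz_open: "openin X U \<Longrightarrow> measure riesz_measure U = content U"
  using emeasure_riesz_measure[OF openin_borel_of] content_nonneg outer_open by (simp add: measure_def)

lemma finite_riesz_measure: "emeasure riesz_measure (space riesz_measure) < \<infinity>"
  using emeasure_riesz_measure[OF openin_borel_of[OF openin_topspace]] by (simp add: space_riesz_measure)

text \<open>Inner regularity at \<open>A\<close> is outer regularity at its complement: the
  complement of an open set close to \<open>topspace X - A\<close> is a compact subset of
  \<open>A\<close>.\<close>

lemma pos_radon_riesz_measure: "pos_radon X riesz_measure"
  unfolding pos_radon_def
proof (intro conjI ballI)
  interpret R: finite_measure riesz_measure
    by (rule finite_measureI) (use finite_riesz_measure in \<open>simp add: less_top\<close>)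
  fix A assume A: "A \<in> sets riesz_measure"
  show "emeasure riesz_measure A = (SUP K\<in>{K. compactin X K \<and> K \<subseteq> A}. emeasure riesz_measure K)"
  proof (rule antisym)
    show "(SUP K\<in>{K. compactin X K \<and> K \<subseteq> A}. emeasure riesz_measure K) \<le> emeasure riesz_measure A"
      using A by (intro SUP_least emeasure_mono) auto
    show "emeasure riesz_measure A \<le> (SUP K\<in>{K. compactin X K \<and> K \<subseteq> A}. emeasure riesz_measure K)"
    proof (rule ennreal_le_epsilon)
      fix e :: real assume e: "0 < e"
      have co: "topspace X - A \<in> sets (borel_of X)"
        using sets.compl_sets[OF A] by (simp add: space_riesz_measure sets_riesz_measure)
      obtain U where U: "openin X U" "topspace X - A \<subseteq> U" "content U < outer (topspace X - A) + e"
        using outer_approx[OF Diff_subset e] .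
      let ?K = "topspace X - U"
      have K: "compactin X ?K" using closedin_compact_space[OF compact] U by blast
      have Ks: "?K \<in> sets riesz_measure" using U closedin_borel_of[of X ?K] by (auto simp: sets_riesz_measure)
      have sub: "?K \<subseteq> A" using U by auto
      have "measure riesz_measure A = measure riesz_measure (topspace X) - measure riesz_measure (topspace X - A)"
        using R.finite_measure_compl[OF A] by (simp add: space_riesz_measure)
      also have "measure riesz_measure (topspace X - A) = outer (topspace X - A)"
        using emeasure_riesz_measure[OF co] outer_nonneg by (simp add: measure_def)
      also have "measure riesz_measure (topspace X) - outer (topspace X - A)
          \<le> measure riesz_measure (topspace X) - measure riesz_measure U + e"
        using U measure_riesz_open by simp
      also have "measure riesz_measure (topspace X) - measure riesz_measure U = measure riesz_measure ?K"
        using R.finite_measure_compl[of U] openin_borel_of[OF U(1)] by (simp add: space_riesz_measure sets_riesz_measure)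
      finally have "emeasure riesz_measure A \<le> ennreal (measure riesz_measure ?K + e)"
        by (simp add: R.emeasure_eq_measure ennreal_leI del: ennreal_plus)
      also have "\<dots> = emeasure riesz_measure ?K + ennreal e"
        using e by (simp add: R.emeasure_eq_measure)
      also have "\<dots> \<le> (SUP K\<in>{K. compactin X K \<and> K \<subseteq> A}. emeasure riesz_measure K) + ennreal e"
        using K sub by (intro add_right_mono SUP_upper) auto
      finally show "emeasure riesz_measure A \<le> (SUP K\<in>{K. compactin X K \<and> K \<subseteq> A}. emeasure riesz_measure K) + ennreal e" .
    qed
  qed
qed (use sets_riesz_measure space_riesz_measure finite_riesz_measure in auto)

section \<open>Integration against the representing measure\<close>

text \<open>Layer-cake decomposition: the summand is the part of \<open>t\<close> between the
  heights \<open>i / n\<close> and \<open>(i + 1) / n\<close>, and the first \<open>k\<close> layers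
  stack up to \<open>t\<close> cut off at \<open>k / n\<close>.\<close>

lemma layer_sum:
  fixes t :: real and n k :: nat
  assumes "t \<ge> 0" "n > 0"
  shows "(\<Sum>i<k. min (max (t - i / n) 0) (1 / n)) = min t (k / n)"
proof (induction k)
  case (Suc k)
  have "min t a + min (max (t - a) 0) b = min t (a + b)" if "b > 0" for a b :: real
    using that by (auto simp: min_def max_def)
  from this[of "1 / n" "k / n"] show ?case
    unfolding sum.lessThan_Suc Suc using assms by (simp add: add_divide_distrib add.commute)
qed (use assms in auto)

text \<open>Slice \<open>f\<close> into layers \<open>h i\<close> of height \<open>1 / n\<close>,
  and let \<open>U i = {f > i / n}\<close>. Since \<open>n * h i\<close> is below
  \<open>U i\<close>, \<open>L (h i)\<close> is at most \<open>content (U i) / n\<close>; since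
  \<open>h i\<close> equals \<open>1 / n\<close> on \<open>U (Suc i)\<close>, its integral is at
  least \<open>content (U (Suc i)) / n\<close>. The two sums differ by a shift of index, which costs
  at most \<open>L 1 / n\<close>.\<close>

lemma le_integral_unit:
  assumes f: "f \<in> cfuns X" and f01: "\<And>x. x \<in> topspace X \<Longrightarrow> 0 \<le> f x \<and> f x \<le> 1"
  shows "L f \<le> integral\<^sup>L riesz_measure f"
proof -
  interpret R: finite_measure riesz_measure
    by (rule finite_measureI) (use finite_riesz_measure in \<open>simp add: less_top\<close>)
  have fc: "continuous_map X euclideanreal f" using f by (simp add: cfuns_def)
  note intgr = cfuns_integrable[OF compact sets_riesz_measure finite_riesz_measure]
  have *: "L f \<le> integral\<^sup>L riesz_measure f + L (\<lambda>x. 1) / n" if n: "n > 0" for n :: nat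
  proof -
    define h where "h = (\<lambda>i x. min (max (f x - real i / n) 0) (1 / n))"
    define U where "U i = {x \<in> topspace X. f x \<in> {real i / n <..}}" for i :: nat
    have hc: "h i \<in> cfuns X" for i
      unfolding h_def cfuns_def using fc by (simp add: continuous_intros)
    have U: "openin X (U i)" for i
      unfolding U_def by (rule openin_continuous_map_preimage[OF fc]) simp
    have hsum: "(\<Sum>i<n. h i x) = f x" if "x \<in> topspace X" for x
      using layer_sum[of "f x" n n] f01[OF that] n by (simp add: h_def)
    have Lh: "L (h i) \<le> content (U i) / n" for i
    proof -
      have "(\<lambda>x. real n * h i x) \<in> below (U i)"
        using function_spaceD(2)[OF function_space_cfuns hc] n
        by (auto simp: below_def h_def U_def field_simps min_def max_def)
      from below_le[OF this] scale[OF hc, of n i] n show ?thesis by (simp add: field_simps)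
    qed
    have Ih: "content (U (Suc i)) / n \<le> integral\<^sup>L riesz_measure (h i)" for i
    proof -
      have "U (Suc i) \<in> sets riesz_measure" using U openin_borel_of sets_riesz_measure by blast
      moreover have "integrable riesz_measure (\<lambda>x. (1/n) * indicator (U (Suc i)) x)"
        using calculation by (simp add: R.emeasure_finite less_top[symmetric])
      moreover have "real (Suc i) / n = i / n + 1 / n" by (simp add: add_divide_distrib)
      ultimately have "integral\<^sup>L riesz_measure (\<lambda>x. (1/n) * indicator (U (Suc i)) x) \<le> integral\<^sup>L riesz_measure (h i)"
        using n by (intro integral_mono[OF _ intgr[OF hc]]) (auto simp: h_def U_def indicator_def)
      then show ?thesis
        using measure_riesz_open[OF U[of "Suc i"]] sets.sets_into_space[OF \<open>U (Suc i) \<in> sets riesz_measure\<close>]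
        by (simp add: Int_absorb2)
    qed
    have "L f \<le> L (\<lambda>x. \<Sum>i<n. h i x)"
      using sum[of n h] hc hsum by (intro mono f) auto
    also have "\<dots> = (\<Sum>i<n. L (h i))" using sum[of n h] hc by blast
    also have "\<dots> \<le> (\<Sum>i<n. content (U i) / n)" by (intro sum_mono Lh)
    \<comment> \<open>Shifting the index telescopes and leaves only the two end terms.\<close>
    also have "\<dots> = (\<Sum>i<n. content (U (Suc i)) / n) + content (U 0) / n - content (U n) / n"
      using sum_lessThan_telescope[of "\<lambda>i. content (U i) / n" n] by (simp add: sum_subtractf)
    also have "\<dots> \<le> (\<Sum>i<n. content (U (Suc i)) / n) + L (\<lambda>x. 1) / n"
    proof -
      have "content (U 0) / n \<le> L (\<lambda>x. 1) / n" "0 \<le> content (U n) / n"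
        using content_le_total content_nonneg by (simp_all add: divide_right_mono)
      then show ?thesis by linarith
    qed
    also have "(\<Sum>i<n. content (U (Suc i)) / n) \<le> (\<Sum>i<n. integral\<^sup>L riesz_measure (h i))"
      by (intro sum_mono Ih)
    also have "\<dots> = integral\<^sup>L riesz_measure (\<lambda>x. \<Sum>i<n. h i x)"
      by (intro Bochner_Integration.integral_sum[symmetric] intgr hc)
    also have "\<dots> = integral\<^sup>L riesz_measure f"
      by (intro Bochner_Integration.integral_cong refl hsum) (simp add: space_riesz_measure)
    finally show ?thesis by simp
  qed
  have "(\<lambda>n. integral\<^sup>L riesz_measure f + L (\<lambda>x. 1) / n) \<longlonglongrightarrow> integral\<^sup>L riesz_measure f + 0"
    by (intro tendsto_intros tendsto_divide_0 filterlim_at_top_imp_at_infinity filterlim_real_sequentially)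
  then show ?thesis
    using * by (intro LIMSEQ_le_const[where X = "\<lambda>n. integral\<^sup>L riesz_measure f + L (\<lambda>x. 1) / n"])
      (auto intro!: exI[of _ 1])
qed

text \<open>For values in \<open>[0,1]\<close> the one-sided estimate applies to both
  \<open>h\<close> and \<open>1 - h\<close>, which gives equality; the general case follows by an
  affine rescaling.\<close>

theorem integral_riesz_measure:
  assumes f: "f \<in> cfuns X"
  shows "integral\<^sup>L riesz_measure f = L f"
proof -
  interpret R: finite_measure riesz_measure
    by (rule finite_measureI) (use finite_riesz_measure in \<open>simp add: less_top\<close>)
  note intgr = cfuns_integrable[OF compact sets_riesz_measure finite_riesz_measure]
  note CD = function_spaceD[OF function_space_cfuns[of X]]
  have total: "integral\<^sup>L riesz_measure (\<lambda>x. c) = L (\<lambda>x. c)" for c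
    using measure_riesz_open[OF openin_topspace] content_topspace scale[of "\<lambda>x. 1" c]
    by (simp add: space_riesz_measure)
  have unit: "integral\<^sup>L riesz_measure h = L h"
    if h: "h \<in> cfuns X" "\<And>x. x \<in> topspace X \<Longrightarrow> 0 \<le> h x \<and> h x \<le> 1" for h
  proof -
    have c: "(\<lambda>x. 1 + (-1) * h x) \<in> cfuns X" by (intro CD(1,2) const_cfuns h)
    have "L (\<lambda>x. 1 + (-1) * h x) \<le> integral\<^sup>L riesz_measure (\<lambda>x. 1 + (-1) * h x)"
      using h by (intro le_integral_unit c) auto
    moreover have "L (\<lambda>x. 1 + (-1) * h x) = L (\<lambda>x. 1) - L h"
      using add[OF const_cfuns CD(2)[OF h(1)], of 1 "-1"] scale[OF h(1), of "-1"] by simp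
    moreover have "integral\<^sup>L riesz_measure (\<lambda>x. 1 + (-1) * h x) = L (\<lambda>x. 1) - integral\<^sup>L riesz_measure h"
      using total[of 1] intgr[OF h(1)] by simp
    ultimately show ?thesis using le_integral_unit[OF h] by linarith
  qed
  obtain B where B: "\<forall>x\<in>topspace X. \<bar>f x\<bar> \<le> B"
    using compact_space_bounded_cfuns[OF compact f] by auto
  define b where "b = \<bar>B\<bar> + 1"
  have b: "b > 0" by (simp add: b_def)
  \<comment> \<open>This affine map carries \<open>[-b, b]\<close> onto
    \<open>[0, 1]\<close>.\<close>
  define h where "h = (\<lambda>x. 1/2 + (1 / (2 * b)) * f x)"
  have h: "h \<in> cfuns X" unfolding h_def by (intro CD(1,2) const_cfuns f)
  have fb: "- b \<le> f x \<and> f x \<le> b" if "x \<in> topspace X" for x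
    using B that by (fastforce simp: b_def)
  have "0 \<le> h x \<and> h x \<le> 1" if "x \<in> topspace X" for x
    using fb[OF that] b by (simp add: h_def field_simps)
  then have "integral\<^sup>L riesz_measure h = L h" by (intro unit h)
  moreover have "L h = L (\<lambda>x. 1/2) + (1 / (2 * b)) * L f"
    unfolding h_def using add[OF const_cfuns CD(2)[OF f], of "1/2" "1 / (2 * b)"] scale[OF f, of "1 / (2 * b)"] by simp
  moreover have "integral\<^sup>L riesz_measure h = L (\<lambda>x. 1/2) + (1 / (2 * b)) * integral\<^sup>L riesz_measure f"
    unfolding h_def using total[of "1/2"] intgr[OF f] by simp
  ultimately show ?thesis using b by simp
qed

end

section \<open>The compactifications\<close>

text \<open>Density and the Hausdorff property make a continuous extension unique on the space. The
  definition also prescribes \<open>undefined\<close> elsewhere, hence the modified copy of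
  \<open>F\<close>.\<close>

lemma cext_eqI:
  assumes dense: "X closure_of (e ` A) = topspace X" and emb: "e ` A \<subseteq> topspace X" and Y: "Hausdorff_space Y"
    and F: "continuous_map X Y F" "\<And>a. a \<in> A \<Longrightarrow> F (e a) = f a"
  shows "cext X Y e A f = (\<lambda>x. if x \<in> topspace X then F x else undefined)"
  unfolding cext_def
proof (rule the_equality)
  have "continuous_map X Y (\<lambda>x. if x \<in> topspace X then F x else undefined)"
    by (rule continuous_map_eq[OF F(1)]) simp
  then show "continuous_map X Y (\<lambda>x. if x \<in> topspace X then F x else undefined) \<and>
    (\<forall>a\<in>A. (if e a \<in> topspace X then F (e a) else undefined) = f a) \<and>
    (\<forall>x. x \<notin> topspace X \<longrightarrow> (if x \<in> topspace X then F x else undefined) = undefined)"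
    using F(2) emb by auto
  fix E assume E: "continuous_map X Y E \<and> (\<forall>a\<in>A. E (e a) = f a) \<and> (\<forall>x. x \<notin> topspace X \<longrightarrow> E x = undefined)"
  show "E = (\<lambda>x. if x \<in> topspace X then F x else undefined)"
  proof
    fix x
    have "E x = F x" if "x \<in> topspace X"
      by (rule forall_in_closure_of_eq[of x X "e ` A" Y]) (use that dense Y E F in auto)
    then show "E x = (if x \<in> topspace X then F x else undefined)" using E by auto
  qed
qed

lemma
  assumes "X closure_of (e ` A) = topspace X" "e ` A \<subseteq> topspace X" "Hausdorff_space Y"
    and F: "continuous_map X Y F" "\<And>a. a \<in> A \<Longrightarrow> F (e a) = f a"
  shows cext_eq: "x \<in> topspace X \<Longrightarrow> cext X Y e A f x = F x"
    and continuous_map_cext: "continuous_map X Y (cext X Y e A f)"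
    and cext_emb: "a \<in> A \<Longrightarrow> cext X Y e A f (e a) = f a"
proof -
  show 1: "cext X Y e A f x = F x" if "x \<in> topspace X" for x
    using that by (simp add: cext_eqI[OF assms])
  show "continuous_map X Y (cext X Y e A f)"
    by (rule continuous_map_eq[OF F(1)]) (simp add: 1)
  show "cext X Y e A f (e a) = f a" if "a \<in> A" for a
    using that 1[of "e a"] F(2) assms(2) by auto
qed

text \<open>The points of \<open>W\<close> with \<open>F > G\<close> form an open set, which would
  meet \<open>D\<close> if it were nonempty. Localising to \<open>W\<close> allows inequalities that
  hold only on part of the dense set.\<close>

lemma le_on_open_if_le_on_dense:
  fixes F G :: "'b \<Rightarrow> real"
  assumes dense: "X closure_of D = topspace X" and W: "openin X W" and x: "x \<in> W"
    and F: "continuous_map X euclideanreal F" and G: "continuous_map X euclideanreal G"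
    and le: "\<And>z. z \<in> D \<Longrightarrow> z \<in> W \<Longrightarrow> F z \<le> G z"
  shows "F x \<le> G x"
proof (rule ccontr)
  assume "\<not> F x \<le> G x"
  let ?V = "{z \<in> topspace X. F z - G z \<in> {0<..}} \<inter> W"
  have "openin X ?V"
    by (intro openin_Int W openin_continuous_map_preimage[where Y = euclideanreal] continuous_intros F G) auto
  moreover have "x \<in> topspace X" using x W openin_subset by blast
  moreover have "x \<in> ?V" using \<open>\<not> F x \<le> G x\<close> calculation x by simp
  moreover have "x \<in> X closure_of D" using dense calculation(2) by simp
  ultimately obtain z where "z \<in> D" "z \<in> ?V"
    unfolding in_closure_of by meson
  then show False using le[of z] by simp
qed

text \<open>The common shape of \<^const>\<open>betaTop\<close> and \<^const>\<open>uTop\<close>.\<close>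

definition cube_emb :: "('c \<Rightarrow> real) set \<Rightarrow> 'c \<Rightarrow> (('c \<Rightarrow> real) \<Rightarrow> real)" where
  "cube_emb I z = restrict (\<lambda>g. g z) I"

definition cube_closure :: "('c \<Rightarrow> real) set \<Rightarrow> 'c set \<Rightarrow> (('c \<Rightarrow> real) \<Rightarrow> real) topology" where
  "cube_closure I A = (let P = product_topology (\<lambda>_. top_of_set {0..1::real}) I
     in subtopology P (P closure_of (cube_emb I ` A)))"

context
  fixes I :: "('c \<Rightarrow> real) set" and A :: "'c set"
  assumes I: "\<forall>g\<in>I. g ` A \<subseteq> {0..1}"
begin

lemma cube_emb_in: "cube_emb I ` A \<subseteq> topspace (product_topology (\<lambda>_. top_of_set {0..1::real}) I)"
  using I by (fastforce simp: cube_emb_def)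

lemma topspace_cube_closure:
  "topspace (cube_closure I A) = product_topology (\<lambda>_. top_of_set {0..1::real}) I closure_of (cube_emb I ` A)"
  by (simp add: cube_closure_def Let_def topspace_subtopology Int_absorb1 closure_of_subset_topspace
      del: topspace_product_topology)

lemma cube_emb_in_topspace: "cube_emb I ` A \<subseteq> topspace (cube_closure I A)"
  unfolding topspace_cube_closure by (rule closure_of_subset[OF cube_emb_in])

lemma dense_cube_closure: "cube_closure I A closure_of (cube_emb I ` A) = topspace (cube_closure I A)"
  using cube_emb_in_topspace unfolding topspace_cube_closure
  by (simp add: cube_closure_def Let_def closure_of_subtopology Int_absorb1)

lemma compact_cube_closure: "compact_space (cube_closure I A)"
  unfolding cube_closure_def Let_def
  by (intro compact_space_subtopology closedin_compact_space closedin_closure_of)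
    (simp add: compact_space_product_topology compact_space_subtopology)

lemma Hausdorff_cube_closure: "Hausdorff_space (cube_closure I A)"
  unfolding cube_closure_def Let_def
  by (intro Hausdorff_space_subtopology) (simp add: Hausdorff_space_product_topology Hausdorff_space_subtopology)

lemma continuous_map_cube_coord: "g \<in> I \<Longrightarrow> continuous_map (cube_closure I A) euclideanreal (\<lambda>\<zeta>. \<zeta> g)"
  unfolding cube_closure_def Let_def
  by (rule continuous_map_from_subtopology)
    (use continuous_map_product_projection[of g I "\<lambda>_. top_of_set {0..1::real}"] in
      \<open>simp add: continuous_map_in_subtopology\<close>)

lemma cube_coord_range: "\<zeta> \<in> topspace (cube_closure I A) \<Longrightarrow> g \<in> I \<Longrightarrow> 0 \<le> \<zeta> g \<and> \<zeta> g \<le> 1"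
  unfolding topspace_cube_closure
  using closure_of_subset_topspace[of "product_topology (\<lambda>_. top_of_set {0..1::real}) I" "cube_emb I ` A"]
  by (fastforce simp: PiE_iff)

lemma cube_extensional: "\<zeta> \<in> topspace (cube_closure I A) \<Longrightarrow> \<zeta> \<in> extensional I"
  unfolding topspace_cube_closure
  using closure_of_subset_topspace[of "product_topology (\<lambda>_. top_of_set {0..1::real}) I" "cube_emb I ` A"]
  by (fastforce simp: PiE_iff)

text \<open>Continuity into the cube is checked by coordinates; the dense set \<open>D\<close> lands
  among the embedded points, so the whole image lands in their closure.\<close>

lemma continuous_map_into_cube_closure:
  assumes dense: "X closure_of D = topspace X" and ext: "F ` topspace X \<subseteq> extensional I"
    and cont: "\<And>g. g \<in> I \<Longrightarrow> continuous_map X (top_of_set {0..1}) (\<lambda>x. F x g)"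
    and D: "F ` D \<subseteq> cube_emb I ` A"
  shows "continuous_map X (cube_closure I A) F"
proof -
  let ?P = "product_topology (\<lambda>_. top_of_set {0..1::real}) I"
  have c: "continuous_map X ?P F"
    using ext cont by (auto simp: continuous_map_componentwise)
  have "F ` topspace X \<subseteq> ?P closure_of (cube_emb I ` A)"
    using continuous_map_image_closure_subset[OF c, of D] closure_of_mono[OF D, of ?P] dense by auto
  then show ?thesis
    using c unfolding cube_closure_def Let_def continuous_map_in_subtopology by auto
qed

end

section \<open>Extensions to the Stone-Cech and Samuel compactifications\<close>

lemma betaTop_eq: "betaTop = cube_closure betaIdx Mtil" and betaEmb_eq: "betaEmb = cube_emb betaIdx"
  by (auto simp: betaTop_def betaEmb_def cube_closure_def cube_emb_def Let_def fun_eq_iff cong: image_cong)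

lemma uTop_eq: "uTop = cube_closure uIdx UNIV" and uEmb_eq: "uEmb = cube_emb uIdx"
  by (auto simp: uTop_def uEmb_def cube_closure_def cube_emb_def Let_def fun_eq_iff cong: image_cong)

lemma betaIdx_range: "\<forall>g\<in>betaIdx. g ` Mtil \<subseteq> {0..1}"
  by (auto simp: betaIdx_def)

lemma uIdx_range: "\<forall>g\<in>uIdx. range g \<subseteq> {0..1}"
  by (auto simp: uIdx_def)

lemmas dense_betaTop = dense_cube_closure[OF betaIdx_range, folded betaTop_eq betaEmb_eq]
  and betaEmb_in = cube_emb_in_topspace[OF betaIdx_range, folded betaTop_eq betaEmb_eq]
  and compact_betaTop = compact_cube_closure[OF betaIdx_range, folded betaTop_eq betaEmb_eq]
  and Hausdorff_betaTop = Hausdorff_cube_closure[OF betaIdx_range, folded betaTop_eq betaEmb_eq]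
  and continuous_map_beta_coord = continuous_map_cube_coord[OF betaIdx_range, folded betaTop_eq betaEmb_eq]

lemmas dense_uTop = dense_cube_closure[OF uIdx_range, folded uTop_eq uEmb_eq]
  and uEmb_in = cube_emb_in_topspace[OF uIdx_range, folded uTop_eq uEmb_eq]
  and Hausdorff_uTop = Hausdorff_cube_closure[OF uIdx_range, folded uTop_eq uEmb_eq]
  and continuous_map_u_coord = continuous_map_cube_coord[OF uIdx_range, folded uTop_eq uEmb_eq]
  and u_coord_range = cube_coord_range[OF uIdx_range, folded uTop_eq uEmb_eq]
  and u_extensional = cube_extensional[OF uIdx_range, folded uTop_eq uEmb_eq]
  and continuous_map_into_uTop = continuous_map_into_cube_closure[OF uIdx_range, folded uTop_eq uEmb_eq]

lemma uEmb_apply: "w \<in> uIdx \<Longrightarrow> uEmb x w = w x"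
  by (simp add: uEmb_def)

text \<open>The coordinates of \<open>betaTop\<close> are functions into \<open>[0,1]\<close>, so
  \<open>k\<close> is rescaled affinely to such a coordinate \<open>h\<close>, and the rescaling is
  undone on the value of that coordinate.\<close>

lemma beta_extension:
  fixes k :: "'a::metric_space \<times> 'a \<Rightarrow> real"
  assumes k: "continuous_on Mtil k" and B: "\<forall>z\<in>Mtil. \<bar>k z\<bar> \<le> B"
  shows "\<exists>F. continuous_map betaTop euclideanreal F \<and> (\<forall>z\<in>Mtil. F (betaEmb z) = k z)"
proof -
  define b where "b = \<bar>B\<bar> + 1"
  have b: "b > 0" "\<And>z. z \<in> Mtil \<Longrightarrow> - b \<le> k z \<and> k z \<le> b"
    using B by (force simp: b_def)+
  define h where "h = (\<lambda>z. if z \<in> Mtil then (k z / b + 1) / 2 else 0)"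
  have "continuous_on Mtil (\<lambda>z. (k z / b + 1) / 2)"
    using b by (intro continuous_intros k) auto
  then have "continuous_on Mtil h"
    by (rule continuous_on_eq) (simp add: h_def)
  moreover have "h z \<in> {0..1}" if "z \<in> Mtil" for z
    using b(2)[OF that] b(1) that by (simp add: h_def field_simps)
  ultimately have h: "h \<in> betaIdx"
    by (auto simp: betaIdx_def h_def)
  show ?thesis
  proof (intro exI conjI ballI)
    show "continuous_map betaTop euclideanreal (\<lambda>\<zeta>. b * (2 * \<zeta> h - 1))"
      by (intro continuous_intros continuous_map_beta_coord h) auto
    show "b * (2 * betaEmb z h - 1) = k z" if "z \<in> Mtil" for z
      using that b(1) h by (simp add: betaEmb_def h_def field_simps)
  qed
qed

lemma beta_le_on_open:
  fixes F G :: "((('a::metric_space \<times> 'a) \<Rightarrow> real) \<Rightarrow> real) \<Rightarrow> real"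
  assumes "openin betaTop W" "\<zeta> \<in> W" "continuous_map betaTop euclideanreal F" "continuous_map betaTop euclideanreal G"
    and "\<And>x y. x \<noteq> y \<Longrightarrow> betaEmb (x,y) \<in> W \<Longrightarrow> F (betaEmb (x,y)) \<le> G (betaEmb (x,y))"
  shows "F \<zeta> \<le> G \<zeta>"
  by (rule le_on_open_if_le_on_dense[OF dense_betaTop assms(1-4)])
    (use assms(5) in \<open>auto simp: Mtil_def\<close>)

lemma beta_le:
  fixes F G :: "((('a::metric_space \<times> 'a) \<Rightarrow> real) \<Rightarrow> real) \<Rightarrow> real"
  assumes "\<zeta> \<in> topspace betaTop" "continuous_map betaTop euclideanreal F" "continuous_map betaTop euclideanreal G"
    and "\<And>x y. x \<noteq> y \<Longrightarrow> F (betaEmb (x,y)) \<le> G (betaEmb (x,y))"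
  shows "F \<zeta> \<le> G \<zeta>"
  by (rule beta_le_on_open[OF openin_topspace assms(1-3) assms(4)])

lemma u_le:
  fixes F G :: "(('a::metric_space \<Rightarrow> real) \<Rightarrow> real) \<Rightarrow> real"
  assumes "\<xi> \<in> topspace uTop" "continuous_map uTop euclideanreal F" "continuous_map uTop euclideanreal G"
    and "\<And>x. F (uEmb x) \<le> G (uEmb x)"
  shows "F \<xi> \<le> G \<xi>"
  by (rule le_on_open_if_le_on_dense[OF dense_uTop openin_topspace assms(1-3)])
    (use assms(4) in auto)

text \<open>A Lipschitz constant bounds the difference quotients, so \<open>beta_extension\<close>
  supplies the extension that the description in \<open>Phi\<close> asks for.\<close>

lemma continuous_Phi:
  assumes f: "C-lipschitz_on UNIV f"
  shows "continuous_map betaTop euclideanreal (Phi f)"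
    and "x \<noteq> y \<Longrightarrow> Phi f (betaEmb (x,y)) = (f x - f y) / dist x y"
proof -
  have fc: "continuous_on UNIV f" by (rule lipschitz_on_continuous_on[OF f])
  have c: "continuous_on Mtil (\<lambda>(x,y). (f x - f y) / dist x y)"
    unfolding split_def
    by (intro continuous_intros continuous_on_compose2[OF fc]) (auto simp: Mtil_def)
  have "\<bar>f x - f y\<bar> \<le> C * dist x y" for x y
    using lipschitz_onD[OF f, of x y] by (simp add: dist_real_def)
  then have bound: "\<forall>z\<in>Mtil. \<bar>case z of (x,y) \<Rightarrow> (f x - f y) / dist x y\<bar> \<le> C"
    by (auto simp: Mtil_def field_simps)
  obtain F where F: "continuous_map betaTop euclideanreal F"
    "\<forall>z\<in>Mtil. F (betaEmb z) = (case z of (x,y) \<Rightarrow> (f x - f y) / dist x y)"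
    using beta_extension[OF c bound] by (elim exE conjE)
  note * = dense_betaTop betaEmb_in Hausdorff_space_euclidean F(1)
  show "continuous_map betaTop euclideanreal (Phi f)"
    unfolding Phi_def by (rule continuous_map_cext[OF *, OF bspec[OF F(2)]])
  show "Phi f (betaEmb (x,y)) = (f x - f y) / dist x y" if "x \<noteq> y"
    unfolding Phi_def using that by (subst cext_emb[OF *, OF bspec[OF F(2)]]) (auto simp: Mtil_def)
qed

text \<open>Composition with \<open>\<pi>\<close> turns a coordinate \<open>w\<close> of
  \<open>uTop\<close> into a coordinate \<open>T w\<close> of \<open>betaTop\<close>; reading off
  the coordinates \<open>T w\<close> is the extension.\<close>

lemma continuous_map_coordinate_ext:
  fixes \<pi> :: "'a::metric_space \<times> 'a \<Rightarrow> 'a"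
  assumes \<pi>: "continuous_on UNIV \<pi>"
  shows "continuous_map betaTop uTop (cext betaTop uTop betaEmb Mtil (\<lambda>z. uEmb (\<pi> z)))"
    and "z \<in> Mtil \<Longrightarrow> cext betaTop uTop betaEmb Mtil (\<lambda>z. uEmb (\<pi> z)) (betaEmb z) = uEmb (\<pi> z)"
proof -
  define T where "T w = (\<lambda>z. if z \<in> Mtil then w (\<pi> z) else 0 :: real)" for w
  have T: "T w \<in> betaIdx" if w: "w \<in> uIdx" for w
  proof -
    have "continuous_on UNIV w"
      using w uniformly_continuous_imp_continuous by (auto simp: uIdx_def)
    then have "continuous_on Mtil (\<lambda>z. w (\<pi> z))"
      by (rule continuous_on_compose2[OF _ continuous_on_subset[OF \<pi>]]) auto
    then have "continuous_on Mtil (T w)"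
      by (rule continuous_on_eq) (simp add: T_def)
    then show ?thesis using bspec[OF uIdx_range w] by (auto simp: betaIdx_def T_def)
  qed
  define F where "F \<zeta> = restrict (\<lambda>w. \<zeta> (T w)) uIdx" for \<zeta> :: "('a \<times> 'a \<Rightarrow> real) \<Rightarrow> real"
  have emb: "F (betaEmb z) = uEmb (\<pi> z)" if "z \<in> Mtil" for z
    using that T by (auto simp: F_def uEmb_def betaEmb_def T_def)
  have "continuous_map betaTop uTop F"
  proof (rule continuous_map_into_uTop[OF dense_betaTop])
    show "F ` topspace betaTop \<subseteq> extensional uIdx" by (auto simp: F_def)
    show "F ` betaEmb ` Mtil \<subseteq> range uEmb" using emb by auto
    fix w :: "'a \<Rightarrow> real" assume w: "w \<in> uIdx"
    show "continuous_map betaTop (top_of_set {0..1}) (\<lambda>\<zeta>. F \<zeta> w)"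
      using w continuous_map_beta_coord[OF T[OF w]] cube_coord_range[OF betaIdx_range, folded betaTop_eq, OF _ T[OF w]]
      by (auto simp: F_def continuous_map_in_subtopology)
  qed
  note * = dense_betaTop betaEmb_in Hausdorff_uTop this
  show "continuous_map betaTop uTop (cext betaTop uTop betaEmb Mtil (\<lambda>z. uEmb (\<pi> z)))"
    by (rule continuous_map_cext[OF *, OF emb])
  show "cext betaTop uTop betaEmb Mtil (\<lambda>z. uEmb (\<pi> z)) (betaEmb z) = uEmb (\<pi> z)" if "z \<in> Mtil"
    by (rule cext_emb[OF *, OF emb that])
qed

lemma
  shows continuous_map_p1: "continuous_map betaTop uTop p1"
    and continuous_map_p2: "continuous_map betaTop uTop p2"
    and p1_betaEmb: "x \<noteq> y \<Longrightarrow> p1 (betaEmb (x,y)) = uEmb x"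
    and p2_betaEmb: "x \<noteq> y \<Longrightarrow> p2 (betaEmb (x,y)) = uEmb y"
  unfolding p1_def p2_def
  using continuous_map_coordinate_ext[OF continuous_on_fst[OF continuous_on_id]]
    continuous_map_coordinate_ext[OF continuous_on_snd[OF continuous_on_id]]
  by (auto simp: Mtil_def)

lemma
  assumes w: "w \<in> uIdx"
  shows continuous_map_p1_coord: "continuous_map betaTop euclideanreal (\<lambda>\<zeta>. p1 \<zeta> w)"
    and continuous_map_p2_coord: "continuous_map betaTop euclideanreal (\<lambda>\<zeta>. p2 \<zeta> w)"
  using continuous_map_compose[OF continuous_map_p1 continuous_map_u_coord[OF w]]
    continuous_map_compose[OF continuous_map_p2 continuous_map_u_coord[OF w]]
  by (auto simp: o_def)

lemma
  assumes "\<zeta> \<in> topspace betaTop"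
  shows p1_in: "p1 \<zeta> \<in> topspace uTop" and p2_in: "p2 \<zeta> \<in> topspace uTop"
  using continuous_map_p1 continuous_map_p2 assms by (auto simp: continuous_map_def)

section \<open>Distances in the Samuel compactification\<close>

text \<open>The cap at 1 makes the distance a coordinate of \<open>uTop\<close>, so
  \<open>\<xi> (udist s)\<close> is the capped distance from \<open>\<xi>\<close> to
  \<open>s\<close>.\<close>

definition udist :: "'a::metric_space \<Rightarrow> 'a \<Rightarrow> real" where
  "udist s x = min 1 (dist x s)"

text \<open>A bounded substitute for the uncapped distance: \<open>\<xi> (uinv s)\<close> vanishes
  exactly at infinite distance from \<open>s\<close>.\<close>

definition uinv :: "'a::metric_space \<Rightarrow> 'a \<Rightarrow> real" where
  "uinv s x = 1 / (1 + dist x s)"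

lemma uIdx_if_nonexpansive:
  fixes w :: "'a::metric_space \<Rightarrow> real"
  assumes "\<And>x y. w x \<le> w y + dist x y" "\<And>x. 0 \<le> w x" "\<And>x. w x \<le> 1"
  shows "w \<in> uIdx"
proof -
  have "\<bar>w x - w y\<bar> \<le> dist x y" for x y
    using assms(1)[of x y] assms(1)[of y x] by (simp add: dist_commute)
  then have "1-lipschitz_on UNIV w" by (intro lipschitz_onI) (auto simp: dist_real_def)
  then show ?thesis
    using assms(2,3) by (auto simp: uIdx_def intro: lipschitz_on_uniformly_continuous)
qed

lemma udist_in: "udist s \<in> uIdx"
proof (rule uIdx_if_nonexpansive)
  show "udist s x \<le> udist s y + dist x y" for x y
    using dist_triangle[of x s y] zero_le_dist[of x y] unfolding udist_def by linarith
qed (auto simp: udist_def)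

lemma uinv_in: "uinv s \<in> uIdx"
proof (rule uIdx_if_nonexpansive)
  show "uinv s x \<le> uinv s y + dist x y" for x y
  proof -
    have "uinv s x - uinv s y = (dist y s - dist x s) / ((1 + dist x s) * (1 + dist y s))"
      by (simp add: uinv_def diff_frac_eq add_nonneg_eq_0_iff add_pos_nonneg less_imp_neq[THEN not_sym])
    also have "\<dots> \<le> dist x y / ((1 + dist x s) * (1 + dist y s))"
      using dist_triangle2[of y s x] dist_triangle[of y s x]
      by (intro divide_right_mono) (auto simp: dist_commute)
    also have "\<dots> \<le> dist x y / 1"
      using mult_mono[of 1 "1 + dist x s" 1 "1 + dist y s"] by (intro divide_left_mono) auto
    finally show ?thesis by simp
  qed
qed (auto simp: uinv_def divide_le_eq add_pos_nonneg)

text \<open>Solving \<open>t = 1 / (1 + d)\<close> for \<open>d\<close> gives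
  \<open>1 / t - 1\<close>, which is continuous from \<open>[0,1]\<close> to the extended reals
  since the inverse of 0 is infinity there.\<close>

lemma d0bar_eq:
  assumes "\<xi> \<in> topspace uTop"
  shows "d0bar x0 \<xi> = inverse (ereal (\<xi> (uinv x0))) - 1"
  unfolding d0bar_def
proof (rule cext_eq[where F = "\<lambda>\<xi>. inverse (ereal (\<xi> (uinv x0))) - 1"])
  have "continuous_on {0..1::real} (\<lambda>t. inverse (ereal t))"
    by (rule continuous_on_compose2[OF continuous_on_inverse_ereal]) (auto intro!: continuous_intros)
  then have "continuous_on {0..1::real} (\<lambda>t. inverse (ereal t) - 1)"
    unfolding continuous_on_def by (intro ballI tendsto_diff_ereal_general tendsto_const) auto
  moreover have "continuous_map uTop (top_of_set {0..1}) (\<lambda>\<xi>. \<xi> (uinv x0))"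
    using continuous_map_u_coord[OF uinv_in] u_coord_range[OF _ uinv_in, of _ x0]
    by (simp add: continuous_map_in_subtopology image_subset_iff)
  ultimately show "continuous_map uTop euclidean (\<lambda>\<xi>. inverse (ereal (\<xi> (uinv x0))) - 1)"
    using continuous_map_compose[of uTop "top_of_set {0..1}" "\<lambda>\<xi>. \<xi> (uinv x0)" euclidean "\<lambda>t. inverse (ereal t) - 1"]
    by (simp add: o_def)
  show "inverse (ereal (uEmb x (uinv x0))) - 1 = ereal (dist x x0)" for x
  proof -
    have "1 + dist x x0 > 0" by (simp add: add_pos_nonneg)
    then show ?thesis by (simp add: uEmb_apply[OF uinv_in] uinv_def one_ereal_def)
  qed
  show "Hausdorff_space (euclidean :: ereal topology)"
    unfolding Hausdorff_space_def disjnt_def using hausdorff by (metis open_openin)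
qed (use dense_uTop uEmb_in assms in auto)

text \<open>Finite distance from \<open>x0\<close> becomes an open condition on a single coordinate,
  which makes the relevant sets Borel.\<close>

lemma RM_eq: "RM x0 = {\<xi> \<in> topspace uTop. 0 < \<xi> (uinv x0)}"
proof -
  have "d0bar x0 \<xi> < \<infinity> \<longleftrightarrow> 0 < \<xi> (uinv x0)" if \<xi>: "\<xi> \<in> topspace uTop" for \<xi>
    using u_coord_range[OF \<xi> uinv_in, of x0] by (cases "\<xi> (uinv x0) = 0") (auto simp: d0bar_eq[OF \<xi>] one_ereal_def)
  then show ?thesis by (auto simp: RM_def)
qed

text \<open>Completeness enters here. Points \<open>s n\<close> ever closer to \<open>\<xi>\<close>
  form a Cauchy sequence, their limit \<open>l\<close> has capped distance 0 from
  \<open>\<xi>\<close>, and uniform continuity forces every coordinate of \<open>\<xi>\<close> to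
  agree with that of \<open>l\<close>. Hence a point outside the image of the space has positive
  distance from it.\<close>

lemma in_range_uEmb_iff:
  fixes \<xi> :: "('a::complete_space \<Rightarrow> real) \<Rightarrow> real"
  assumes \<xi>: "\<xi> \<in> topspace uTop"
  shows "\<xi> \<in> range uEmb \<longleftrightarrow> (\<forall>n. \<exists>s. \<xi> (udist s) < 1 / real (Suc n))"
proof
  assume "\<xi> \<in> range uEmb"
  then obtain s where "\<xi> = uEmb s" by blast
  then have "\<xi> (udist s) = 0" by (simp add: uEmb_apply udist_in udist_def)
  then have "\<xi> (udist s) < 1 / real (Suc n)" for n by simp
  then show "\<forall>n. \<exists>s. \<xi> (udist s) < 1 / real (Suc n)" by blast
next
  note c = continuous_map_u_coord[OF udist_in]
  assume "\<forall>n. \<exists>s. \<xi> (udist s) < 1 / real (Suc n)"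
  then obtain s where s: "\<And>n. \<xi> (udist (s n)) < 1 / real (Suc n)" by metis
  \<comment> \<open>The triangle inequality through a point \<open>x\<close>, extended by density
    from \<open>x\<close> to \<open>\<xi>\<close>.\<close>
  have tri: "udist b a \<le> \<xi> (udist a) + \<xi> (udist b)" for a b
  proof (rule u_le[OF \<xi>])
    fix x
    show "udist b a \<le> uEmb x (udist a) + uEmb x (udist b)"
      using dist_triangle[of a b x] dist_commute[of a x] zero_le_dist[of x a] zero_le_dist[of x b]
      unfolding uEmb_apply[OF udist_in] udist_def by linarith
  qed (auto intro!: continuous_intros c)
  have "Cauchy s"
  proof (rule metric_CauchyI)
    fix e :: real assume e: "e > 0"
    \<comment> \<open>The minimum with 1 ensures that a small capped distance is the true
      distance.\<close>
    obtain N where N: "1 / real (Suc N) < min e 1 / 2"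
      using e reals_Archimedean[of "min e 1 / 2"] by (auto simp: inverse_eq_divide)
    have "dist (s m) (s n) < e" if "m \<ge> N" "n \<ge> N" for m n
    proof -
      have "1 / real (Suc m) \<le> 1 / real (Suc N)" "1 / real (Suc n) \<le> 1 / real (Suc N)"
        using that by (auto intro!: divide_left_mono)
      then have "udist (s n) (s m) < min e 1"
        using tri[of "s n" "s m"] s[of m] s[of n] N by linarith
      then show ?thesis by (auto simp: udist_def min_def split: if_splits)
    qed
    then show "\<exists>M. \<forall>m\<ge>M. \<forall>n\<ge>M. dist (s m) (s n) < e" by blast
  qed
  then obtain l where l: "s \<longlonglongrightarrow> l" using Cauchy_convergent convergent_def by blast
  have "\<xi> (udist l) \<le> \<xi> (udist (s n)) + dist (s n) l" for n
  proof (rule u_le[OF \<xi>])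
    fix x
    show "uEmb x (udist l) \<le> uEmb x (udist (s n)) + dist (s n) l"
      using dist_triangle[of x l "s n"] zero_le_dist[of "s n" l] unfolding uEmb_apply[OF udist_in] udist_def by linarith
  qed (auto intro!: continuous_intros c)
  then have "\<xi> (udist l) \<le> 1 / real (Suc n) + dist (s n) l" for n
    using s[of n] by (smt (verit))
  moreover have "(\<lambda>n. 1 / real (Suc n) + dist (s n) l) \<longlonglongrightarrow> 0 + 0"
    using l by (intro tendsto_add LIMSEQ_Suc[OF lim_1_over_n] tendsto_dist_iff[THEN iffD1]) auto
  ultimately have l0: "\<xi> (udist l) \<le> 0"
    by (intro LIMSEQ_le_const[where X = "\<lambda>n. 1 / real (Suc n) + dist (s n) l"]) auto
  have "\<xi> w = w l" if w: "w \<in> uIdx" for w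
  proof -
    note cw = continuous_map_u_coord[OF w]
    have w01: "0 \<le> w x" "w x \<le> 1" for x using bspec[OF uIdx_range w] by (auto simp: image_subset_iff)
    have "\<bar>\<xi> w - w l\<bar> \<le> e" if e: "e > 0" for e
    proof -
      obtain r0 where r0: "r0 > 0" "\<And>x. dist x l < r0 \<Longrightarrow> dist (w x) (w l) < e"
        by (rule uniformly_continuous_onE[of UNIV w, OF _ e]) (use w in \<open>auto simp: uIdx_def\<close>)
      define r where "r = min 1 r0"
      have r: "r > 0" "r \<le> 1" "\<And>x. dist x l < r \<Longrightarrow> \<bar>w x - w l\<bar> < e"
        using r0 by (auto simp: r_def dist_real_def)
      \<comment> \<open>Within \<open>r\<close> of \<open>l\<close> uniform continuity gives the
        bound \<open>e\<close>; farther away the second term is at least 1, the largest possible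
        oscillation of \<open>w\<close>. At \<open>\<xi>\<close> the second term disappears.\<close>
      have pt: "\<bar>w x - w l\<bar> \<le> e + (1/r) * udist l x" for x
      proof (cases "dist x l < r")
        case True
        have "0 \<le> (1/r) * udist l x" using r by (simp add: udist_def)
        then show ?thesis using r(3)[OF True] by linarith
      next
        case False
        then have "1 \<le> (1/r) * udist l x" using r by (simp add: udist_def field_simps)
        then show ?thesis using w01[of x] w01[of l] e by linarith
      qed
      have "\<xi> w \<le> w l + e + (1/r) * \<xi> (udist l)"
        by (rule u_le[OF \<xi>])
          (use pt r(1) in \<open>auto intro!: continuous_intros c cw simp: uEmb_apply[OF udist_in] uEmb_apply[OF w] abs_le_iff algebra_simps\<close>)
      moreover have "w l - e \<le> \<xi> w + (1/r) * \<xi> (udist l)"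
        by (rule u_le[OF \<xi>])
          (use pt r(1) in \<open>auto intro!: continuous_intros c cw simp: uEmb_apply[OF udist_in] uEmb_apply[OF w] abs_le_iff algebra_simps\<close>)
      moreover have "(1/r) * \<xi> (udist l) \<le> 0" using l0 r(1) by (simp add: divide_le_0_iff)
      ultimately show ?thesis by linarith
    qed
    then have "\<bar>\<xi> w - w l\<bar> \<le> 0" by (meson dense_ge)
    then show ?thesis by simp
  qed
  then have "\<xi> = uEmb l"
    using u_extensional[OF \<xi>] by (intro extensionalityI[of _ uIdx]) (auto simp: uEmb_def)
  then show "\<xi> \<in> range uEmb" by blast
qed

section \<open>Minimal measures\<close>

lemma GsetD:
  assumes "g \<in> Gset"
  shows "continuous_map betaTop euclideanreal g"
    and "x \<noteq> u \<Longrightarrow> u \<noteq> y \<Longrightarrow> x \<noteq> y \<Longrightarrow>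
      dist x y * g (betaEmb (x,y)) \<le> dist x u * g (betaEmb (x,u)) + dist u y * g (betaEmb (u,y))"
  using assms by (auto simp: Gset_def)

text \<open>The condition is \<open>c\<close> times the triangle inequality. Constants guarantee
  that every continuous function has a majorant in \<open>Gset\<close>.\<close>

lemma const_Gset: "c \<ge> 0 \<Longrightarrow> (\<lambda>_. c) \<in> Gset"
  by (auto simp: Gset_def distrib_right[symmetric] dist_triangle intro!: mult_right_mono)

lemma add_Gset: "g \<in> Gset \<Longrightarrow> h \<in> Gset \<Longrightarrow> (\<lambda>x. g x + h x) \<in> Gset"
  unfolding Gset_def by (fastforce simp: distrib_left intro: continuous_map_add)

lemma scale_Gset:
  assumes "g \<in> Gset" "c \<ge> 0" shows "(\<lambda>x. c * g x) \<in> Gset"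
proof -
  have "dist x y * (c * g (betaEmb (x,y))) \<le> dist x u * (c * g (betaEmb (x,u))) + dist u y * (c * g (betaEmb (u,y)))"
    if "x \<noteq> u" "u \<noteq> y" "x \<noteq> y" for x u y
    using mult_left_mono[OF GsetD(2)[OF assms(1) that] assms(2)] by (simp add: algebra_simps)
  then show ?thesis
    using GsetD(1)[OF assms(1)] by (auto simp: Gset_def intro: continuous_map_real_mult_left)
qed

text \<open>Testing minimality of \<open>\<mu>\<close> against a measure \<open>\<nu>\<close> dominated by the sublinear functional
  \<open>k \<mapsto> inf {\<integral>g d\<mu> | g \<in> G, g \<ge> k}\<close> that attains it at \<open>-g\<^sub>0\<close>.\<close>

lemma minimal_majorant:
  fixes \<mu> :: "((('a::metric_space \<times> 'a) \<Rightarrow> real) \<Rightarrow> real) measure"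
  assumes radon: "pos_radon betaTop \<mu>" and minimal: "preceq_minimal \<mu>" and g0: "g0 \<in> Gset" and e: "e > 0"
  obtains g where "g \<in> Gset" "\<forall>\<zeta>\<in>topspace betaTop. - g0 \<zeta> \<le> g \<zeta>"
    "integral\<^sup>L \<mu> g + integral\<^sup>L \<mu> g0 \<le> e"
proof -
  let ?X = "betaTop :: ((('a \<times> 'a) \<Rightarrow> real) \<Rightarrow> real) topology"
  let ?V = "cfuns ?X"
  note V = function_space_cfuns[of ?X]
  have sets: "sets \<mu> = sets (borel_of ?X)" and fin: "emeasure \<mu> (space \<mu>) < \<infinity>"
    using radon by (auto simp: pos_radon_def)
  have space: "space \<mu> = topspace ?X" using sets_eq_imp_space_eq[OF sets] by simp
  note intgr = cfuns_integrable[OF compact_betaTop sets fin]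
  have GV: "g \<in> ?V" if "g \<in> Gset" for g using GsetD(1)[OF that] by (simp add: cfuns_def)
  have mono: "integral\<^sup>L \<mu> f \<le> integral\<^sup>L \<mu> h"
    if "f \<in> ?V" "h \<in> ?V" "\<And>\<zeta>. \<zeta> \<in> topspace ?X \<Longrightarrow> f \<zeta> \<le> h \<zeta>" for f h
    using that by (intro integral_mono intgr) (auto simp: space)
  define M where "M k = {g \<in> Gset. \<forall>\<zeta>\<in>topspace ?X. k \<zeta> \<le> g \<zeta>}" for k
  define Q where "Q k = (INF g\<in>M k. integral\<^sup>L \<mu> g)" for k
  have MG: "g \<in> Gset" "g \<in> ?V" if "g \<in> M k" for g k using that GV by (auto simp: M_def)
  have ne: "M k \<noteq> {}" if k: "k \<in> ?V" for k
  proof -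
    obtain B where "\<forall>\<zeta>\<in>topspace ?X. \<bar>k \<zeta>\<bar> \<le> B"
      using compact_space_bounded_cfuns[OF compact_betaTop k] by auto
    then have "(\<lambda>_. \<bar>B\<bar>) \<in> M k" using const_Gset[of "\<bar>B\<bar>"] by (force simp: M_def)
    then show ?thesis by auto
  qed
  have lower: "integral\<^sup>L \<mu> k \<le> integral\<^sup>L \<mu> g" if "k \<in> ?V" "g \<in> M k" for k g
    using that MG(2)[OF that(2)] by (intro mono) (auto simp: M_def)
  have Q_le: "Q k \<le> integral\<^sup>L \<mu> g" if "k \<in> ?V" "g \<in> M k" for k g
    unfolding Q_def using that lower by (intro cINF_lower bdd_belowI2[where m = "integral\<^sup>L \<mu> k"]) auto
  have Q_ge: "c \<le> Q k" if "k \<in> ?V" "\<And>g. g \<in> M k \<Longrightarrow> c \<le> integral\<^sup>L \<mu> g" for k c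
    unfolding Q_def using that by (intro cINF_greatest ne)
  have add: "Q (\<lambda>x. f x + h x) \<le> Q f + Q h" if f: "f \<in> ?V" and h: "h \<in> ?V" for f h
  proof -
    have *: "Q (\<lambda>x. f x + h x) \<le> integral\<^sup>L \<mu> g1 + integral\<^sup>L \<mu> g2" if g: "g1 \<in> M f" "g2 \<in> M h" for g1 g2
    proof -
      have "(\<lambda>x. g1 x + g2 x) \<in> M (\<lambda>x. f x + h x)"
        using g by (auto simp: M_def intro!: add_Gset add_mono)
      from Q_le[OF function_spaceD(1)[OF V f h] this] show ?thesis
        using intgr[OF MG(2)[OF g(1)]] intgr[OF MG(2)[OF g(2)]] by simp
    qed
    have "Q (\<lambda>x. f x + h x) - integral\<^sup>L \<mu> g1 \<le> Q h" if "g1 \<in> M f" for g1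
      using *[OF that] by (intro Q_ge h) (simp add: algebra_simps)
    then have "Q (\<lambda>x. f x + h x) - Q h \<le> Q f"
      by (intro Q_ge f) (simp add: algebra_simps)
    then show ?thesis by simp
  qed
  have scale_le: "Q (\<lambda>x. c * f x) \<le> c * Q f" if f: "f \<in> ?V" and c: "c > 0" for f c
  proof -
    have "Q (\<lambda>x. c * f x) / c \<le> integral\<^sup>L \<mu> g" if g: "g \<in> M f" for g
    proof -
      have "(\<lambda>x. c * g x) \<in> M (\<lambda>x. c * f x)"
        using g c scale_Gset[of g c] by (auto simp: M_def)
      from Q_le[OF function_spaceD(2)[OF V f] this] show ?thesis using c by (simp add: field_simps)
    qed
    then have "Q (\<lambda>x. c * f x) / c \<le> Q f" by (intro Q_ge f)
    then show ?thesis using c by (simp add: field_simps)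
  qed
  have Q0: "Q (\<lambda>x. 0) = 0"
  proof (rule antisym)
    show "Q (\<lambda>x. 0) \<le> 0"
      using Q_le[OF function_spaceD(4)[OF V], of "\<lambda>_. 0"] const_Gset[of 0] by (simp add: M_def)
    show "0 \<le> Q (\<lambda>x. 0)"
      using lower[OF function_spaceD(4)[OF V]] by (intro Q_ge function_spaceD(4)[OF V]) simp
  qed
  have "Q (\<lambda>x. c * f x) = c * Q f" if f: "f \<in> ?V" and c: "c \<ge> 0" for f c
  proof (cases "c = 0")
    case True then show ?thesis using Q0 by simp
  next
    case False
    then have c: "c > 0" using c by simp
    have "Q f \<le> (1/c) * Q (\<lambda>x. c * f x)"
      using scale_le[OF function_spaceD(2)[OF V f, of c], of "1/c"] c by simp
    then show ?thesis using scale_le[OF f c] c by (simp add: field_simps)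
  qed
  then have Qs: "sublinear_on ?V Q" using add by (auto simp: sublinear_on_def)
  have k: "(\<lambda>x. - g0 x) \<in> ?V" using function_spaceD(3)[OF V GV[OF g0]] .
  obtain L where L: "linear_functional_on ?V L" and LQ: "\<And>f. f \<in> ?V \<Longrightarrow> L f \<le> Q f"
    and Lk: "L (\<lambda>x. - g0 x) = Q (\<lambda>x. - g0 x)"
    using exists_linear_le_sublinear_attaining[OF V Qs k] by blast
  have Lminus: "L (\<lambda>x. - f x) = - L f" if "f \<in> ?V" for f
    using L[unfolded linear_functional_on_def, THEN conjunct2, rule_format, OF that, of "-1"] by simp
  interpret positive_functional ?X L
  proof
    show "0 \<le> L f" if f: "f \<in> ?V" and "\<And>x. x \<in> topspace ?X \<Longrightarrow> 0 \<le> f x" for f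
    proof -
      \<comment> \<open>For \<open>f \<ge> 0\<close> the zero function majorises \<open>- f\<close>,
        so \<open>L (- f) \<le> Q (- f) \<le> 0\<close>.\<close>
      have "(\<lambda>_. 0) \<in> M (\<lambda>x. - f x)" using that const_Gset[of 0] by (auto simp: M_def)
      then have "L (\<lambda>x. - f x) \<le> 0"
        using LQ[OF function_spaceD(3)[OF V f]] Q_le[OF function_spaceD(3)[OF V f]] by force
      then show ?thesis using Lminus[OF f] by simp
    qed
  qed (use compact_betaTop Hausdorff_betaTop L in auto)
  have "preceq riesz_measure \<mu>"
    unfolding preceq_def
  proof
    fix g :: "((('a \<times> 'a) \<Rightarrow> real) \<Rightarrow> real) \<Rightarrow> real" assume g: "g \<in> Gset"
    \<comment> \<open>Each member of \<open>Gset\<close> is its own majorant, hence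
      \<open>L g \<le> Q g \<le> \<integral>g d\<mu>\<close>.\<close>
    then have "g \<in> M g" by (simp add: M_def)
    then show "integral\<^sup>L riesz_measure g \<le> integral\<^sup>L \<mu> g"
      using integral_riesz_measure[OF GV[OF g]] LQ[OF GV[OF g]] Q_le[OF GV[OF g]] by force
  qed
  then have "preceq \<mu> riesz_measure"
    using minimal pos_radon_riesz_measure by (simp add: preceq_minimal_def)
  then have "integral\<^sup>L \<mu> g0 \<le> L g0"
    using g0 integral_riesz_measure[OF GV[OF g0]] by (auto simp: preceq_def)
  \<comment> \<open>Attainment gives \<open>Q (- g0) = - L g0\<close>, which minimality bounds by
    \<open>- \<integral>g0 d\<mu>\<close>; a nearly optimal majorant then has the required
    integral.\<close>
  then have "Q (\<lambda>x. - g0 x) < e - integral\<^sup>L \<mu> g0"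
    using Lk Lminus[OF GV[OF g0]] e by simp
  then obtain g where g: "g \<in> M (\<lambda>x. - g0 x)" "integral\<^sup>L \<mu> g < e - integral\<^sup>L \<mu> g0"
    unfolding Q_def using ne[OF k] by (meson cINF_greatest not_le)
  show ?thesis
    by (rule that[of g]) (use g in \<open>auto simp: M_def\<close>)
qed

text \<open>With a third point available, \<open>H(x,w) \<le> H(x,u) + H(u,w)\<close> and \<open>H(u,w) \<le> H(u,x) + H(x,w)\<close>
  add up to \<open>0 \<le> H(x,u) + H(u,x)\<close>, so the triangle inequality survives \<open>x = y\<close>.\<close>

lemma Gset_hemimetric:
  fixes g :: "((('a::metric_space \<times> 'a) \<Rightarrow> real) \<Rightarrow> real) \<Rightarrow> real"
  assumes three: "\<exists>a b c :: 'a. a \<noteq> b \<and> b \<noteq> c \<and> a \<noteq> c" and g: "g \<in> Gset"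
    and H: "\<And>x y. H x y = (if x = y then 0 else dist x y * g (betaEmb (x,y)))"
  shows "H x y \<le> H x u + H u y"
proof (cases "x = u \<or> u = y")
  case True
  then show ?thesis by (auto simp: H)
next
  case False
  then have xu: "x \<noteq> u" "u \<noteq> y" by auto
  show ?thesis
  proof (cases "x = y")
    case False
    then show ?thesis using GsetD(2)[OF g xu False] xu by (simp add: H)
  next
    case True
    obtain w where w: "w \<noteq> x" "w \<noteq> u" using three by metis
    have "H x w \<le> H x u + H u w" "H u w \<le> H u x + H x w"
      using GsetD(2)[OF g, of x u w] GsetD(2)[OF g, of u x w] xu w by (auto simp: H)
    then show ?thesis using True by (simp add: H)
  qed
qed

section \<open>Test functions built from hemimetrics\<close>

lemma Min_le_Min_add:
  fixes a b :: "'i \<Rightarrow> real"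
  assumes "finite S" "S \<noteq> {}" "\<And>s. s \<in> S \<Longrightarrow> a s \<le> b s + c"
  shows "Min (a ` S) \<le> Min (b ` S) + c"
proof -
  have "Min (b ` S) \<in> b ` S" using assms by (intro Min_in) auto
  then obtain s where s: "s \<in> S" "Min (b ` S) = b s" by auto
  have "Min (a ` S) \<le> a s" using assms(1) s(1) by (intro Min_le) auto
  then show ?thesis using assms(3)[OF s(1)] s(2) by linarith
qed

text \<open>The increments of \<open>K\<close> are controlled by \<open>H\<close>, but
  \<open>K\<close> may be negative. Adding \<open>T\<close> compensates for this, at a cost of at
  most \<open>min \<delta> (dist x y)\<close>; beyond distance \<open>\<delta>\<close> from
  \<open>S\<close> the function \<open>T\<close> is constant and the cost disappears.\<close>

lemma hemimetric_potential:
  fixes H :: "'a::metric_space \<Rightarrow> 'a \<Rightarrow> real"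
  assumes tri: "\<And>x u y. H x y \<le> H x u + H u y" and refl: "\<And>x. H x x = 0"
    and low: "\<And>x y. - min \<delta> (dist x y) \<le> H x y" and up: "\<And>x y. H x y \<le> B * dist x y"
    and B: "0 \<le> B" and \<delta>: "0 < \<delta>" and S: "finite S" "S \<noteq> {}"
  obtains F where "\<forall>s\<in>S. F s = 0" "\<forall>x y. F y - F x \<le> (B + 1) * dist x y"
    "\<forall>x y. F y - F x \<le> H x y + min \<delta> (dist x y)"
    "\<forall>x y. (\<forall>s\<in>S. \<delta> \<le> dist x s \<and> \<delta> \<le> dist y s) \<longrightarrow> F y - F x \<le> H x y"
proof -
  define K where "K x = Min ((\<lambda>s. H s x) ` S)" for x
  define T where "T x = min \<delta> (Min ((\<lambda>s. dist s x) ` S))" for x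
  \<comment> \<open>On \<open>S\<close> the sum \<open>K + T\<close> is at most 0, so the maximum
    makes \<open>F\<close> vanish there exactly.\<close>
  define F where "F x = max 0 (K x + T x)" for x
  have K: "K y \<le> K x + H x y" for x y
    unfolding K_def by (rule Min_le_Min_add[OF S tri])
  have T: "T y - T x \<le> min \<delta> (dist x y)" for x y
  proof -
    have "Min ((\<lambda>s. dist s y) ` S) \<le> Min ((\<lambda>s. dist s x) ` S) + dist x y"
      by (rule Min_le_Min_add[OF S dist_triangle])
    moreover have nonneg: "0 \<le> Min ((\<lambda>s. dist s z) ` S)" for z
      using S by (subst Min_ge_iff) auto
    ultimately show ?thesis
      using \<delta> zero_le_dist[of x y] nonneg[of x] nonneg[of y] unfolding T_def by linarith
  qed
  \<comment> \<open>Handles increments for which the maximum at \<open>y\<close> is attained by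
    0.\<close>
  have KT: "0 \<le> H x y + min \<delta> (dist x y)" for x y
    using low[of x y] by linarith
  have 1: "F s = 0" if s: "s \<in> S" for s
  proof -
    have "K s \<le> H s s" "Min ((\<lambda>t. dist t s) ` S) \<le> dist s s"
      using S s unfolding K_def by (auto intro!: Min_le)
    then have "K s + T s \<le> 0" using refl[of s] \<delta> unfolding T_def by auto
    then show ?thesis by (simp add: F_def)
  qed
  have 2: "F y - F x \<le> H x y + min \<delta> (dist x y)" for x y
    using K[of y x] T[of y x] KT[of x y] unfolding F_def by linarith
  have 3: "F y - F x \<le> (B + 1) * dist x y" for x y
    using 2[of y x] up[of x y] by (simp add: distrib_right)
  \<comment> \<open>Here \<open>T = \<delta>\<close> at both points, and
    \<open>K y \<ge> - \<delta>\<close> makes the maximum at \<open>y\<close> equal to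
    \<open>K y + \<delta>\<close>.\<close>
  have 4: "F y - F x \<le> H x y" if far: "\<forall>s\<in>S. \<delta> \<le> dist x s \<and> \<delta> \<le> dist y s" for x y
  proof -
    have "\<delta> \<le> Min ((\<lambda>s. dist s x) ` S)" "\<delta> \<le> Min ((\<lambda>s. dist s y) ` S)"
      using S far by (auto simp: Min_ge_iff dist_commute)
    then have Teq: "T x = \<delta>" "T y = \<delta>" by (auto simp: T_def)
    have "- \<delta> \<le> H s y" for s using low[of s y] by linarith
    then have "- \<delta> \<le> K y" using S by (simp add: K_def Min_ge_iff)
    then show ?thesis using K[of y x] Teq unfolding F_def by linarith
  qed
  show ?thesis by (rule that[of F]) (use 1 2 3 4 in blast)+
qed

text \<open>The triangle inequality for \<open>min \<delta> d\<close> puts the ratio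
  \<open>min \<delta> d / d\<close> into \<open>Gset\<close>. The ratio may tend to 0 for distant
  pairs, so its positivity in the limit is derived from the finiteness of both distances to
  \<open>x0\<close>.\<close>

lemma truncated_ratio_Gset:
  assumes \<delta>: "0 < \<delta>" "\<delta> \<le> 1"
  obtains g0 :: "((('a::metric_space \<times> 'a) \<Rightarrow> real) \<Rightarrow> real) \<Rightarrow> real" where "g0 \<in> Gset"
    "\<forall>x y. x \<noteq> y \<longrightarrow> dist x y * g0 (betaEmb (x,y)) = min \<delta> (dist x y)"
    "\<forall>\<zeta>\<in>topspace betaTop. 0 \<le> g0 \<zeta>"
    "\<forall>\<zeta>\<in>topspace betaTop. p1 \<zeta> (uinv x0) > 0 \<longrightarrow> p2 \<zeta> (uinv x0) > 0 \<longrightarrow> g0 \<zeta> > 0"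
proof -
  have k: "continuous_on Mtil (\<lambda>z. min \<delta> (dist (fst z) (snd z)) / dist (fst z) (snd z :: 'a))"
    by (intro continuous_intros) (auto simp: Mtil_def)
  have bound: "\<forall>z\<in>Mtil. \<bar>min \<delta> (dist (fst z) (snd z)) / dist (fst z) (snd z :: 'a)\<bar> \<le> 1"
    using \<delta> by (auto simp: Mtil_def divide_le_eq_1)
  obtain g0 :: "((('a \<times> 'a) \<Rightarrow> real) \<Rightarrow> real) \<Rightarrow> real"
    where c: "continuous_map betaTop euclideanreal g0"
    and e: "\<forall>z\<in>Mtil. g0 (betaEmb z) = min \<delta> (dist (fst z) (snd z)) / dist (fst z) (snd z)"
    using beta_extension[OF k bound] by (elim exE conjE)
  have g0: "g0 (betaEmb (x,y)) = min \<delta> (dist x y) / dist x y" if "x \<noteq> y" for x y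
    using bspec[OF e, of "(x,y)"] that by (simp add: Mtil_def)
  have lower: "(\<delta> / 2) * (p1 \<zeta> (uinv x0) * p2 \<zeta> (uinv x0)) \<le> g0 \<zeta>" if "\<zeta> \<in> topspace betaTop" for \<zeta>
  proof (rule beta_le[OF that _ c])
    show "continuous_map betaTop euclideanreal (\<lambda>\<zeta>. (\<delta> / 2) * (p1 \<zeta> (uinv x0) * p2 \<zeta> (uinv x0)))"
      by (intro continuous_intros continuous_map_p1_coord continuous_map_p2_coord uinv_in) auto
    fix x y :: 'a assume xy: "x \<noteq> y"
    let ?a = "dist x x0" and ?b = "dist y x0"
    have pos: "1 + ?a > 0" "1 + ?b > 0" by (auto simp: add_pos_nonneg)
    have "dist x y \<le> ?a + ?b" by (rule dist_triangle2)
    also have "\<dots> \<le> 2 * ((1 + ?a) * (1 + ?b))" by (simp add: algebra_simps)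
    finally have 1: "dist x y \<le> 2 * ((1 + ?a) * (1 + ?b))" .
    have frac: "\<delta> / A \<le> m / d" if "A > 0" "d > 0" "\<delta> * d \<le> m * A" for A d m :: real
      using that by (simp add: field_simps)
    \<comment> \<open>The two cases of the minimum: for \<open>dist x y\<close> the bound uses
      \<open>\<delta> \<le> 1\<close>, for \<open>\<delta>\<close> it uses the estimate of
      \<open>dist x y\<close> just proved.\<close>
    have "1 * 1 \<le> (1 + ?a) * (1 + ?b)" by (intro mult_mono) auto
    then have "\<delta> * dist x y \<le> dist x y * (2 * ((1 + ?a) * (1 + ?b)))"
      using \<delta> mult_mono[of \<delta> "2 * ((1 + ?a) * (1 + ?b))" "dist x y" "dist x y"] by (simp add: mult.commute)
    moreover have "\<delta> * dist x y \<le> \<delta> * (2 * ((1 + ?a) * (1 + ?b)))"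
      using \<delta> 1 by (intro mult_left_mono) auto
    ultimately have "\<delta> * dist x y \<le> min \<delta> (dist x y) * (2 * ((1 + ?a) * (1 + ?b)))"
      by (simp add: min_def)
    then have "\<delta> / (2 * ((1 + ?a) * (1 + ?b))) \<le> min \<delta> (dist x y) / dist x y"
      using frac[of "2 * ((1 + ?a) * (1 + ?b))" "dist x y" "min \<delta> (dist x y)"] xy pos by simp
    then show "(\<delta> / 2) * (p1 (betaEmb (x,y)) (uinv x0) * p2 (betaEmb (x,y)) (uinv x0)) \<le> g0 (betaEmb (x,y))"
      using xy by (simp add: g0 p1_betaEmb p2_betaEmb uEmb_apply[OF uinv_in] uinv_def)
  qed
  show ?thesis
  proof (rule that)
    have "dist x y * g0 (betaEmb (x,y)) \<le> dist x u * g0 (betaEmb (x,u)) + dist u y * g0 (betaEmb (u,y))"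
      if "x \<noteq> u" "u \<noteq> y" "x \<noteq> y" for x u y
    proof -
      have "min \<delta> (dist x y) \<le> min \<delta> (dist x u) + min \<delta> (dist u y)"
        using dist_triangle[of x y u] zero_le_dist[of x u] zero_le_dist[of u y] \<delta> by linarith
      then show ?thesis using that by (simp add: g0)
    qed
    then show "g0 \<in> Gset" using c by (simp add: Gset_def)
    show "\<forall>x y. x \<noteq> y \<longrightarrow> dist x y * g0 (betaEmb (x,y)) = min \<delta> (dist x y)"
      by (simp add: g0)
    show "\<forall>\<zeta>\<in>topspace betaTop. 0 \<le> g0 \<zeta>"
      by (rule ballI, rule beta_le[OF _ _ c]) (use \<delta> in \<open>simp_all add: g0\<close>)
    show "\<forall>\<zeta>\<in>topspace betaTop. p1 \<zeta> (uinv x0) > 0 \<longrightarrow> p2 \<zeta> (uinv x0) > 0 \<longrightarrow> g0 \<zeta> > 0"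
    proof (intro ballI impI)
      fix \<zeta> :: "(('a \<times> 'a) \<Rightarrow> real) \<Rightarrow> real"
      assume \<zeta>: "\<zeta> \<in> topspace betaTop" "p1 \<zeta> (uinv x0) > 0" "p2 \<zeta> (uinv x0) > 0"
      then have "0 < (\<delta> / 2) * (p1 \<zeta> (uinv x0) * p2 \<zeta> (uinv x0))" using \<delta> by simp
      then show "g0 \<zeta> > 0" using lower[OF \<zeta>(1)] by linarith
    qed
  qed
qed

section \<open>Points far from the metric space\<close>

text \<open>Through capped distances, and for \<open>0 < c \<le> 1\<close>, these are the points
  both of whose coordinates stay at distance at least \<open>c\<close> from the whole metric
  space.\<close>

definition far :: "real \<Rightarrow> ((('a::metric_space \<times> 'a) \<Rightarrow> real) \<Rightarrow> real) set" where
  "far c = {\<zeta> \<in> topspace betaTop. \<forall>s. c \<le> p1 \<zeta> (udist s) \<and> c \<le> p2 \<zeta> (udist s)}"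

lemma closedin_far: "closedin betaTop (far c)"
proof -
  have "far c = (\<Inter>s. {\<zeta> \<in> topspace betaTop. p1 \<zeta> (udist s) \<in> {c..}} \<inter> {\<zeta> \<in> topspace betaTop. p2 \<zeta> (udist s) \<in> {c..}})"
    by (auto simp: far_def)
  also have "closedin betaTop \<dots>"
    by (intro closedin_INT closedin_Int closedin_continuous_map_preimage[where Y = euclideanreal]
        continuous_map_p1_coord continuous_map_p2_coord udist_in) auto
  finally show ?thesis .
qed

text \<open>A function vanishing on \<open>S\<close> annihilates the combination of evaluations that
  approximates the functional. Including \<open>x0\<close> in \<open>S\<close> puts the function
  into \<open>Lip0 x0\<close>.\<close>

lemma integral_Phi_small:
  assumes F: "PhiStar_in_F x0 \<mu>" and e: "e > 0"
  obtains S where "finite S" "x0 \<in> S"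
    "\<forall>f. 1-lipschitz_on UNIV f \<longrightarrow> (\<forall>s\<in>S. f s = 0) \<longrightarrow> \<bar>integral\<^sup>L \<mu> (Phi f)\<bar> \<le> e"
proof -
  obtain S a where S: "finite S" and b: "\<forall>f\<in>Lip0 x0. 1-lipschitz_on UNIV f \<longrightarrow>
          \<bar>integral\<^sup>L \<mu> (Phi f) - (\<Sum>x\<in>S. a x * f x)\<bar> \<le> e"
    using F e unfolding PhiStar_in_F_def by meson
  show ?thesis
  proof (rule that[of "insert x0 S"])
    show "\<forall>f. 1-lipschitz_on UNIV f \<longrightarrow> (\<forall>s\<in>insert x0 S. f s = 0) \<longrightarrow> \<bar>integral\<^sup>L \<mu> (Phi f)\<bar> \<le> e"
    proof (intro allI impI)
      fix f :: "'a \<Rightarrow> real" assume f: "1-lipschitz_on UNIV f" "\<forall>s\<in>insert x0 S. f s = 0"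
      then have "f \<in> Lip0 x0" by (auto simp: Lip0_def)
      moreover have "(\<Sum>x\<in>S. a x * f x) = 0" using f(2) by (intro sum.neutral) auto
      ultimately show "\<bar>integral\<^sup>L \<mu> (Phi f)\<bar> \<le> e" using bspec[OF b, of f] f(1) by simp
    qed
  qed (use S in auto)
qed

text \<open>The potential \<open>F\<close> satisfies \<open>- \<Phi>F \<le> g + g0\<close>
  everywhere and \<open>- \<Phi>F \<le> g\<close> on \<open>far c\<close>, so the part of
  \<open>g0\<close> over \<open>far c\<close> can be added on the left. After integration,
  \<open>g + g0\<close> and \<open>\<Phi>F\<close> contribute at most \<open>e / 2\<close>
  each.\<close>

lemma far_integral_le:
  fixes \<mu> :: "((('a::metric_space \<times> 'a) \<Rightarrow> real) \<Rightarrow> real) measure"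
  assumes three: "\<exists>a b c :: 'a. a \<noteq> b \<and> b \<noteq> c \<and> a \<noteq> c"
    and radon: "pos_radon betaTop \<mu>" and minimal: "preceq_minimal \<mu>" and inF: "PhiStar_in_F x0 \<mu>"
    and \<delta>: "0 < \<delta>" "\<delta> < c" "c \<le> 1" and g0: "g0 \<in> Gset"
    and g0_eq: "\<And>x y. x \<noteq> y \<Longrightarrow> dist x y * g0 (betaEmb (x,y)) = min \<delta> (dist x y)" and e: "e > 0"
  shows "integral\<^sup>L \<mu> (\<lambda>\<zeta>. indicator (far c) \<zeta> * g0 \<zeta>) \<le> e"
proof -
  let ?X = "betaTop :: ((('a \<times> 'a) \<Rightarrow> real) \<Rightarrow> real) topology"
  have sets: "sets \<mu> = sets (borel_of ?X)" and fin: "emeasure \<mu> (space \<mu>) < \<infinity>"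
    using radon by (auto simp: pos_radon_def)
  have space: "space \<mu> = topspace ?X" using sets_eq_imp_space_eq[OF sets] by simp
  have intgr: "integrable \<mu> f" if "continuous_map ?X euclideanreal f" for f
    using cfuns_integrable[OF compact_betaTop sets fin] that by (simp add: cfuns_def)
  obtain g where g: "g \<in> Gset" "\<forall>\<zeta>\<in>topspace ?X. - g0 \<zeta> \<le> g \<zeta>"
    and gint: "integral\<^sup>L \<mu> g + integral\<^sup>L \<mu> g0 \<le> e / 2"
    using minimal_majorant[OF radon minimal g0 half_gt_zero[OF e]] by blast
  note gc = GsetD(1)[OF g(1)] and g0c = GsetD(1)[OF g0]
  have emb: "betaEmb (x,y) \<in> topspace ?X" if "x \<noteq> y" for x y
    using betaEmb_in that by (force simp: Mtil_def)
  obtain B0 where B0: "\<forall>\<zeta>\<in>topspace ?X. \<bar>g \<zeta>\<bar> \<le> B0"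
    using compact_space_bounded_cfuns[OF compact_betaTop, of g] gc by (auto simp: cfuns_def)
  define B where "B = \<bar>B0\<bar>"
  have B: "0 \<le> B" "\<And>\<zeta>. \<zeta> \<in> topspace ?X \<Longrightarrow> g \<zeta> \<le> B" using B0 by (force simp: B_def)+
  \<comment> \<open>The estimate is applied to \<open>F / (B + 1)\<close>, while \<open>F\<close>
    itself enters the final inequality. Hence the tolerance depends on \<open>B\<close>, and
    \<open>S\<close> is chosen after \<open>g\<close>.\<close>
  obtain S where S: "finite S" "x0 \<in> S" and small: "\<forall>f. 1-lipschitz_on UNIV f \<longrightarrow> (\<forall>s\<in>S. f s = 0)
      \<longrightarrow> \<bar>integral\<^sup>L \<mu> (Phi f)\<bar> \<le> e / (2 * (B + 1))"
  proof -
    have "e / (2 * (B + 1)) > 0" using e B(1) by simp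
    from integral_Phi_small[OF inF this] show thesis using that by blast
  qed
  define H where "H x y = (if x = y then 0 else dist x y * g (betaEmb (x,y)))" for x y
  have low: "- min \<delta> (dist x y) \<le> H x y" for x y
  proof (cases "x = y")
    case False
    have "dist x y * - g0 (betaEmb (x,y)) \<le> dist x y * g (betaEmb (x,y))"
      by (intro mult_left_mono bspec[OF g(2)] emb False) auto
    then show ?thesis using g0_eq[OF False] False by (simp add: H_def)
  qed (use \<delta> in \<open>simp add: H_def\<close>)
  have up: "H x y \<le> B * dist x y" for x y
    using mult_left_mono[OF B(2)[OF emb], of x y "dist x y"] by (simp add: H_def mult.commute)
  have refl: "H x x = 0" for x by (simp add: H_def)
  have "S \<noteq> {}" using S(2) by auto
  from hemimetric_potential[OF Gset_hemimetric[OF three g(1) H_def] refl low up B(1) \<delta>(1) S(1) this]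
  obtain F where F0: "\<forall>s\<in>S. F s = 0" and F1: "\<forall>x y. F y - F x \<le> (B + 1) * dist x y"
    and F2: "\<forall>x y. F y - F x \<le> H x y + min \<delta> (dist x y)"
    and F3: "\<forall>x y. (\<forall>s\<in>S. \<delta> \<le> dist x s \<and> \<delta> \<le> dist y s) \<longrightarrow> F y - F x \<le> H x y"
    by blast
  define f where "f x = F x / (B + 1)" for x
  have f: "1-lipschitz_on UNIV f"
  proof (rule lipschitz_onI)
    fix x y
    have "\<bar>F x - F y\<bar> \<le> (B + 1) * dist x y"
      using F1[rule_format, of x y] F1[rule_format, of y x] by (simp add: dist_commute abs_le_iff)
    then show "dist (f x) (f y) \<le> 1 * dist x y"
      using B(1) by (simp add: f_def dist_real_def diff_divide_distrib[symmetric] abs_divide divide_le_eq mult.commute)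
  qed simp
  note Phic = continuous_Phi(1)[OF f]
  have Phi_eq: "- (B + 1) * Phi f (betaEmb (x,y)) = (F y - F x) / dist x y" if "x \<noteq> y" for x y
  proof -
    have "(B + 1) * f z = F z" for z using B(1) by (simp add: f_def)
    then have "F y - F x = - (B + 1) * (f x - f y)"
      by (metis minus_diff_eq minus_mult_commute mult_minus_right right_diff_distrib)
    then show ?thesis by (simp only: continuous_Phi(2)[OF f that] times_divide_eq_right)
  qed
  have c: "continuous_map ?X euclideanreal (\<lambda>\<zeta>. - (B + 1) * Phi f \<zeta>)"
    by (intro continuous_intros Phic) auto
  have sumc: "continuous_map ?X euclideanreal (\<lambda>\<zeta>. g \<zeta> + g0 \<zeta>)"
    by (intro continuous_intros gc g0c)
  have le_all: "- (B + 1) * Phi f \<zeta> \<le> g \<zeta> + g0 \<zeta>" if "\<zeta> \<in> topspace ?X" for \<zeta>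
  proof (rule beta_le[OF that c sumc])
    fix x y :: 'a assume xy: "x \<noteq> y"
    have "F y - F x \<le> dist x y * (g (betaEmb (x,y)) + g0 (betaEmb (x,y)))"
      using F2[rule_format, where x = x and y = y] g0_eq[OF xy] xy by (simp add: H_def distrib_left)
    then show "- (B + 1) * Phi f (betaEmb (x,y)) \<le> g (betaEmb (x,y)) + g0 (betaEmb (x,y))"
      unfolding Phi_eq[OF xy] using xy by (simp add: pos_divide_le_eq mult.commute)
  qed
  \<comment> \<open>By \<open>\<delta> < c\<close> this contains \<open>far c\<close>, and it is
    open because \<open>S\<close> is finite. Density needs a neighbourhood, since
    \<open>far c\<close> contains no point \<open>betaEmb (x,y)\<close>.\<close>
  define W where "W = topspace ?X \<inter> (\<Inter>s\<in>S. {\<zeta> \<in> topspace ?X. p1 \<zeta> (udist s) \<in> {\<delta><..}} \<inter> {\<zeta> \<in> topspace ?X. p2 \<zeta> (udist s) \<in> {\<delta><..}})"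
  have W: "openin ?X W"
    unfolding W_def using S
    by (intro openin_Int openin_topspace openin_INT2 openin_continuous_map_preimage[where Y = euclideanreal]
        continuous_map_p1_coord continuous_map_p2_coord udist_in) auto
  have le_far: "- (B + 1) * Phi f \<zeta> \<le> g \<zeta>" if "\<zeta> \<in> far c" for \<zeta>
  proof (rule beta_le_on_open[OF W _ c gc])
    have "\<delta> < p1 \<zeta> (udist s)" "\<delta> < p2 \<zeta> (udist s)" for s
      using that \<delta>(2) unfolding far_def by (auto intro: less_le_trans)
    then show "\<zeta> \<in> W" using that by (simp add: W_def far_def)
    fix x y :: 'a assume xy: "x \<noteq> y" "betaEmb (x,y) \<in> W"
    have "\<delta> \<le> dist x s \<and> \<delta> \<le> dist y s" if "s \<in> S" for s
      using xy that unfolding W_def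
      by (auto simp: p1_betaEmb p2_betaEmb uEmb_apply[OF udist_in] udist_def)
    then have "F y - F x \<le> dist x y * g (betaEmb (x,y))"
      using F3[rule_format, where x = x and y = y] xy(1) by (simp add: H_def)
    then show "- (B + 1) * Phi f (betaEmb (x,y)) \<le> g (betaEmb (x,y))"
      unfolding Phi_eq[OF xy(1)] using xy(1) by (simp add: pos_divide_le_eq mult.commute)
  qed
  have far_sets: "far c \<in> sets \<mu>" using closedin_borel_of[OF closedin_far] by (simp add: sets)
  have ind: "integrable \<mu> (\<lambda>\<zeta>. indicator (far c) \<zeta> * g0 \<zeta>)"
    using integrable_mult_indicator[OF far_sets intgr[OF g0c]] by simp
  \<comment> \<open>Pointwise, \<open>le_far\<close> applies on \<open>far c\<close>, where
    \<open>g0\<close> is added on both sides, and \<open>le_all\<close> applies elsewhere.\<close>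
  have "integral\<^sup>L \<mu> (\<lambda>\<zeta>. - (B + 1) * Phi f \<zeta> + indicator (far c) \<zeta> * g0 \<zeta>) \<le> integral\<^sup>L \<mu> (\<lambda>\<zeta>. g \<zeta> + g0 \<zeta>)"
  proof (rule integral_mono[OF Bochner_Integration.integrable_add[OF intgr[OF c] ind] intgr[OF sumc]])
    fix \<zeta> assume "\<zeta> \<in> space \<mu>"
    then show "- (B + 1) * Phi f \<zeta> + indicator (far c) \<zeta> * g0 \<zeta> \<le> g \<zeta> + g0 \<zeta>"
      using le_all[of \<zeta>] le_far[of \<zeta>] space by (cases "\<zeta> \<in> far c") auto
  qed
  then have "- (B + 1) * integral\<^sup>L \<mu> (Phi f) + integral\<^sup>L \<mu> (\<lambda>\<zeta>. indicator (far c) \<zeta> * g0 \<zeta>) \<le> e / 2"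
    using gint Bochner_Integration.integral_add[OF intgr[OF c] ind]
      Bochner_Integration.integral_add[OF intgr[OF gc] intgr[OF g0c]]
    by (simp only: integral_mult_right_zero)
  moreover have "(B + 1) * integral\<^sup>L \<mu> (Phi f) \<le> e / 2"
  proof -
    have "integral\<^sup>L \<mu> (Phi f) \<le> e / (2 * (B + 1))"
      using small[rule_format, OF f] F0 by (simp add: f_def abs_le_iff)
    then show ?thesis using B(1) by (simp add: field_simps)
  qed
  ultimately show ?thesis by (simp add: algebra_simps)
qed

text \<open>With \<open>\<delta> = c / 2\<close> the function \<open>g0\<close> depends on
  \<open>c\<close> but not on \<open>e\<close>, so letting \<open>e\<close> tend to 0 makes its
  integral over \<open>far c\<close> vanish. As \<open>g0\<close> is nonnegative, and positive at
  finite distance from \<open>x0\<close>, that part of \<open>far c\<close> is null.\<close>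

lemma far_null:
  fixes \<mu> :: "((('a::metric_space \<times> 'a) \<Rightarrow> real) \<Rightarrow> real) measure"
  assumes three: "\<exists>a b c :: 'a. a \<noteq> b \<and> b \<noteq> c \<and> a \<noteq> c"
    and radon: "pos_radon betaTop \<mu>" and minimal: "preceq_minimal \<mu>" and inF: "PhiStar_in_F x0 \<mu>"
    and c: "0 < c" "c \<le> 1"
  shows "far c \<inter> {\<zeta> \<in> topspace betaTop. p1 \<zeta> (uinv x0) > 0 \<and> p2 \<zeta> (uinv x0) > 0} \<in> null_sets \<mu>"
proof -
  let ?X = "betaTop :: ((('a \<times> 'a) \<Rightarrow> real) \<Rightarrow> real) topology"
  let ?R = "{\<zeta> \<in> topspace ?X. p1 \<zeta> (uinv x0) \<in> {0<..}} \<inter> {\<zeta> \<in> topspace ?X. p2 \<zeta> (uinv x0) \<in> {0<..}}"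
  have sets: "sets \<mu> = sets (borel_of ?X)" and fin: "emeasure \<mu> (space \<mu>) < \<infinity>"
    using radon by (auto simp: pos_radon_def)
  have space: "space \<mu> = topspace ?X" using sets_eq_imp_space_eq[OF sets] by simp
  obtain g0 :: "((('a \<times> 'a) \<Rightarrow> real) \<Rightarrow> real) \<Rightarrow> real" where g0: "g0 \<in> Gset"
    "\<forall>x y. x \<noteq> y \<longrightarrow> dist x y * g0 (betaEmb (x,y)) = min (c/2) (dist x y)"
    and nonneg: "\<forall>\<zeta>\<in>topspace ?X. 0 \<le> g0 \<zeta>"
    and pos: "\<forall>\<zeta>\<in>topspace ?X. p1 \<zeta> (uinv x0) > 0 \<longrightarrow> p2 \<zeta> (uinv x0) > 0 \<longrightarrow> g0 \<zeta> > 0"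
  proof -
    have "0 < c/2" "c/2 \<le> 1" using c by auto
    from truncated_ratio_Gset[OF this, of x0] show thesis using that by blast
  qed
  have far_sets: "far c \<in> sets \<mu>" using closedin_borel_of[OF closedin_far] by (simp add: sets)
  have "openin ?X ?R"
    by (intro openin_Int openin_continuous_map_preimage[where Y = euclideanreal]
        continuous_map_p1_coord continuous_map_p2_coord uinv_in) auto
  then have R: "?R \<in> sets \<mu>" using openin_borel_of sets by blast
  have int: "integrable \<mu> (\<lambda>\<zeta>. indicator (far c) \<zeta> * g0 \<zeta>)"
    using integrable_mult_indicator[OF far_sets cfuns_integrable[OF compact_betaTop sets fin, of g0]] GsetD(1)[OF g0(1)]
    by (simp add: cfuns_def)
  have "integral\<^sup>L \<mu> (\<lambda>\<zeta>. indicator (far c) \<zeta> * g0 \<zeta>) \<le> 0"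
  proof (rule field_le_epsilon)
    fix e :: real assume "0 < e"
    then show "integral\<^sup>L \<mu> (\<lambda>\<zeta>. indicator (far c) \<zeta> * g0 \<zeta>) \<le> 0 + e"
      using far_integral_le[OF three radon minimal inF _ _ c(2) g0(1), of "c/2" e] g0(2) c(1) by simp
  qed
  moreover have ae: "AE \<zeta> in \<mu>. 0 \<le> indicator (far c) \<zeta> * g0 \<zeta>"
    by (rule AE_I2) (use nonneg space in simp)
  ultimately have "integral\<^sup>L \<mu> (\<lambda>\<zeta>. indicator (far c) \<zeta> * g0 \<zeta>) = 0"
    using integral_nonneg_AE[OF ae] by linarith
  then have "AE \<zeta> in \<mu>. indicator (far c) \<zeta> * g0 \<zeta> = 0"
    using integral_nonneg_eq_0_iff_AE[OF int ae] by simp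
  then have "AE \<zeta> in \<mu>. \<zeta> \<notin> far c \<inter> ?R"
    by eventually_elim (use pos in \<open>force simp: indicator_def split: if_splits\<close>)
  then have "far c \<inter> ?R \<in> null_sets \<mu>"
    using AE_iff_null_sets far_sets R by blast
  moreover have "?R = {\<zeta> \<in> topspace ?X. p1 \<zeta> (uinv x0) > 0 \<and> p2 \<zeta> (uinv x0) > 0}" by auto
  ultimately show ?thesis by metis
qed

theorem theorem5p4:
  fixes x0 :: "'a::complete_space"
    and \<mu> :: "((('a \<times> 'a) \<Rightarrow> real) \<Rightarrow> real) measure"
  assumes three: "\<exists>a b c :: 'a. a \<noteq> b \<and> b \<noteq> c \<and> a \<noteq> c"
    and radon: "pos_radon betaTop \<mu>"
    and minimal: "preceq_minimal \<mu>"
    and conc: "space \<mu> - {\<zeta> \<in> topspace betaTop. p1 \<zeta> \<in> RM x0 \<and> p2 \<zeta> \<in> RM x0} \<in> null_sets \<mu>"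
    and inF: "PhiStar_in_F x0 \<mu>"
  shows "{\<zeta> \<in> topspace betaTop. p1 \<zeta> \<in> RM x0 - range uEmb \<and> p2 \<zeta> \<in> RM x0 - range uEmb}
           \<in> null_sets \<mu>"
proof -
  let ?R = "{\<zeta> \<in> topspace betaTop. p1 \<zeta> (uinv x0) > 0 \<and> p2 \<zeta> (uinv x0) > 0}"
  have "(\<Union>n. far (1 / real (Suc n)) \<inter> ?R) \<in> null_sets \<mu>"
    by (intro null_sets_UN far_null[OF three radon minimal inF]) auto
  \<comment> \<open>Each coordinate outside the image of the space has positive distance from it, so
    countably many thresholds suffice.\<close>
  moreover have "{\<zeta> \<in> topspace betaTop. p1 \<zeta> \<in> RM x0 - range uEmb \<and> p2 \<zeta> \<in> RM x0 - range uEmb}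
      = (\<Union>n. far (1 / real (Suc n)) \<inter> ?R)" (is "?L = ?U")
  proof (rule set_eqI)
    fix \<zeta> :: "(('a \<times> 'a) \<Rightarrow> real) \<Rightarrow> real"
    show "\<zeta> \<in> ?L \<longleftrightarrow> \<zeta> \<in> ?U"
    proof (cases "\<zeta> \<in> topspace betaTop")
      case True
      note p = p1_in[OF True] p2_in[OF True]
      have "(p1 \<zeta> \<notin> range uEmb \<and> p2 \<zeta> \<notin> range uEmb) \<longleftrightarrow> (\<exists>n. \<zeta> \<in> far (1 / real (Suc n)))"
      proof
        assume "p1 \<zeta> \<notin> range uEmb \<and> p2 \<zeta> \<notin> range uEmb"
        then obtain n m where n: "\<And>s. 1 / real (Suc n) \<le> p1 \<zeta> (udist s)" and m: "\<And>s. 1 / real (Suc m) \<le> p2 \<zeta> (udist s)"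
          using in_range_uEmb_iff[OF p(1)] in_range_uEmb_iff[OF p(2)] by (meson not_less)
        \<comment> \<open>The two coordinates come with different thresholds; the smaller one serves
          both.\<close>
        have "1 / real (Suc (max n m)) \<le> 1 / real (Suc n)" "1 / real (Suc (max n m)) \<le> 1 / real (Suc m)"
          by (auto intro!: divide_left_mono)
        then have "\<zeta> \<in> far (1 / real (Suc (max n m)))"
          using n m True order_trans unfolding far_def by blast
        then show "\<exists>n. \<zeta> \<in> far (1 / real (Suc n))" by blast
      next
        assume "\<exists>n. \<zeta> \<in> far (1 / real (Suc n))"
        then show "p1 \<zeta> \<notin> range uEmb \<and> p2 \<zeta> \<notin> range uEmb"
          unfolding in_range_uEmb_iff[OF p(1)] in_range_uEmb_iff[OF p(2)] far_def by (auto simp: not_less)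
      qed
      then show ?thesis using True p by (auto simp: RM_eq)
    qed (auto simp: far_def)
  qed
  ultimately show ?thesis by simp
qed

end
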